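(* Let $(M^{2n+1},\phi,\xi,\eta,g)$ be an almost $\alpha$-paracosymplectic manifold, let $h=\frac12\mathcal{L}_\xi\phi$ and $\mathcal{A}X=-\nabla_X\xi$. Then for all vector fields $X,Y$ on $M$: $$g(hX,Y)=g(X,hY),\qquad h\circ\phi+\phi\circ h=0,\qquad h\xi=0,\qquad \nabla\xi=\alpha\phi^2+\phi\circ h=-\mathcal{A},$$ where $\nabla\xi$ denotes the $(1,1)$-tensor field $X\mapsto\nabla_X\xi$.
   Context: An almost paracontact metric manifold is a smooth manifold $M$ of dimension $2n+1$ with a $(1,1)$-tensor field $\phi$, a vector field $\xi$, a 1-form $\eta$ and a pseudo-Riemannian metric $g$ of signature $(n+1,n)$ such that $\eta(\xi)=1$, $\phi^2=\mathrm{Id}-\eta\otimes\xi$, the eigendistributions of $\phi|_{\ker\eta}$ for the eigenvalues $+1$ and $-1$ both have rank $n$, and $g(\phi X,\phi Y)=-g(X,Y)+\eta(X)\eta(Y)$ (hence $\eta(X)=g(X,\xi)$, $\phi\xi=0$, $\eta\circ\phi=0$). Its fundamental 2-form is $\Phi(X,Y)=g(\phi X,Y)$. It is almost $\alpha$-paracosymplectic, where $\alpha$ is a smooth real function on $M$ (possibly constant), if $d\eta=0$ and $d\Phi=2\alpha\,\eta\wedge\Phi$ (with $d$ and $\wedge$ normalized compatibly, so that the cyclic sum of $(\nabla_X\Phi)(Y,Z)$ equals $2\alpha$ times the cyclic sum of $\eta(X)\Phi(Y,Z)$). $\nabla$ is the Levi-Civita connection of $g$ and $\mathcal{L}$ the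 Lie derivative. *)

theory Defs
  imports "HOL-Analysis.Analysis" "HOL-Library.Function_Algebras"
begin

instantiation "fun" :: (type, real_vector) real_vector
begin

definition scaleR_fun :: "real \<Rightarrow> ('a \<Rightarrow> 'b) \<Rightarrow> 'a \<Rightarrow> 'b"
  where "scaleR_fun c f = (\<lambda>x. c *\<^sub>R f x)"

instance
  by standard (simp_all add: scaleR_fun_def fun_eq_iff scaleR_add_right scaleR_add_left)

end


subsection \<open>Smooth manifolds\<close>

text \<open>On an open subset of a Euclidean space, \<open>Ck_on k\<close> is the class of \<open>k\<close> times continuously
  differentiable maps: all directional derivatives of a \<open>C\<close>-\<open>(k+1)\<close> map are \<open>C\<close>-\<open>k\<close>.\<close>

fun Ck_on :: "nat \<Rightarrow> 'e::euclidean_space set \<Rightarrow> ('e \<Rightarrow> 'b::euclidean_space) \<Rightarrow> bool" where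
  "Ck_on 0 S f \<longleftrightarrow> continuous_on S f"
| "Ck_on (Suc k) S f \<longleftrightarrow>
     f differentiable_on S \<and> (\<forall>v. Ck_on k S (\<lambda>x. frechet_derivative f (at x) v))"

definition smooth_on :: "'e::euclidean_space set \<Rightarrow> ('e \<Rightarrow> 'b::euclidean_space) \<Rightarrow> bool"
  where "smooth_on S f \<longleftrightarrow> (\<forall>k. Ck_on k S f)"

text \<open>The manifold is the whole type \<open>'a\<close>; the Hausdorff property and second countability are
  supplied by its type class, and the model space is the Euclidean space \<open>'e\<close>.
  A chart is a pair of its domain and its coordinate map.\<close>

type_synonym ('a, 'e) chart = "'a set \<times> ('a \<Rightarrow> 'e)"

definition is_chart :: "('a::topological_space, 'e::euclidean_space) chart \<Rightarrow> bool" where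
  "is_chart = (\<lambda>(U, c). open U \<and> open (c ` U) \<and> homeomorphism U (c ` U) c (inv_into U c))"

definition smooth_atlas ::
    "('a::{t2_space, second_countable_topology}, 'e::euclidean_space) chart set \<Rightarrow> bool" where
  "smooth_atlas A \<longleftrightarrow>
     (\<forall>C\<in>A. is_chart C) \<and>
     (\<Union>(U, c)\<in>A. U) = UNIV \<and>
     (\<forall>(U, c)\<in>A. \<forall>(V, d)\<in>A. smooth_on (c ` (U \<inter> V)) (d \<circ> inv_into U c))"

definition smooth_functions ::
    "('a::topological_space, 'e::euclidean_space) chart set \<Rightarrow> ('a \<Rightarrow> real) set" where
  "smooth_functions A = {f. \<forall>(U, c)\<in>A. smooth_on (c ` U) (f \<circ> inv_into U c)}"


subsection \<open>Tangent spaces and vector fields\<close>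

text \<open>Tangent vectors at \<open>p\<close> are the derivations at \<open>p\<close> of the algebra of smooth functions. As HOL
  functions are total, a derivation is given the value 0 on functions that are not smooth, so that
  equal derivations are equal as HOL functions.\<close>

type_synonym 'a tvec = "('a \<Rightarrow> real) \<Rightarrow> real"
type_synonym 'a vfield = "'a \<Rightarrow> 'a tvec"

definition tangent_space ::
    "('a::topological_space, 'e::euclidean_space) chart set \<Rightarrow> 'a \<Rightarrow> 'a tvec set" where
  "tangent_space A p = {v.
     (\<forall>f. f \<notin> smooth_functions A \<longrightarrow> v f = 0) \<and>
     (\<forall>f\<in>smooth_functions A. \<forall>g\<in>smooth_functions A. v (\<lambda>x. f x + g x) = v f + v g) \<and>
     (\<forall>c. \<forall>f\<in>smooth_functions A. v (\<lambda>x. c * f x) = c * v f) \<and>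
     (\<forall>f\<in>smooth_functions A. \<forall>g\<in>smooth_functions A.
        v (\<lambda>x. f x * g x) = f p * v g + g p * v f)}"

definition vector_fields ::
    "('a::topological_space, 'e::euclidean_space) chart set \<Rightarrow> 'a vfield set" where
  "vector_fields A = {X.
     (\<forall>p. X p \<in> tangent_space A p) \<and>
     (\<forall>f\<in>smooth_functions A. (\<lambda>p. X p f) \<in> smooth_functions A)}"

definition fscale :: "('a \<Rightarrow> real) \<Rightarrow> 'a vfield \<Rightarrow> 'a vfield"
  where "fscale f X = (\<lambda>p. f p *\<^sub>R X p)"

text \<open>On a function that is not smooth the bracket below is 0, as required of a tangent vector,
  because then \<open>\<lambda>q. Y q f\<close> and \<open>\<lambda>q. X q f\<close> are the zero function.\<close>

definition lie_bracket :: "'a vfield \<Rightarrow> 'a vfield \<Rightarrow> 'a vfield"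
  where "lie_bracket X Y = (\<lambda>p f. X p (\<lambda>q. Y q f) - Y p (\<lambda>q. X q f))"


subsection \<open>Tensor fields\<close>

text \<open>A tensor field assigns to each point \<open>p\<close> a multilinear map on the tangent space at \<open>p\<close>; it is
  smooth if it takes smooth vector fields to smooth vector fields or functions. Its values on
  arguments that are not tangent at \<open>p\<close> are irrelevant.\<close>

definition linear_on :: "'v::real_vector set \<Rightarrow> ('v \<Rightarrow> 'w::real_vector) \<Rightarrow> bool" where
  "linear_on V L \<longleftrightarrow>
     (\<forall>u\<in>V. \<forall>v\<in>V. L (u + v) = L u + L v) \<and> (\<forall>c. \<forall>v\<in>V. L (c *\<^sub>R v) = c *\<^sub>R L v)"

type_synonym 'a form1 = "'a \<Rightarrow> 'a tvec \<Rightarrow> real"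
type_synonym 'a form2 = "'a \<Rightarrow> 'a tvec \<Rightarrow> 'a tvec \<Rightarrow> real"
type_synonym 'a tensor11 = "'a \<Rightarrow> 'a tvec \<Rightarrow> 'a tvec"

definition app11 :: "'a tensor11 \<Rightarrow> 'a vfield \<Rightarrow> 'a vfield"
  where "app11 T X = (\<lambda>p. T p (X p))"

definition is_tensor11 ::
    "('a::topological_space, 'e::euclidean_space) chart set \<Rightarrow> 'a tensor11 \<Rightarrow> bool" where
  "is_tensor11 A T \<longleftrightarrow>
     (\<forall>p. linear_on (tangent_space A p) (T p) \<and> T p ` tangent_space A p \<subseteq> tangent_space A p) \<and>
     (\<forall>X\<in>vector_fields A. app11 T X \<in> vector_fields A)"

definition is_form1 ::
    "('a::topological_space, 'e::euclidean_space) chart set \<Rightarrow> 'a form1 \<Rightarrow> bool" where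
  "is_form1 A \<omega> \<longleftrightarrow>
     (\<forall>p. linear_on (tangent_space A p) (\<omega> p)) \<and>
     (\<forall>X\<in>vector_fields A. (\<lambda>p. \<omega> p (X p)) \<in> smooth_functions A)"

definition has_signature ::
    "'v::real_vector set \<Rightarrow> ('v \<Rightarrow> 'v \<Rightarrow> real) \<Rightarrow> nat \<Rightarrow> nat \<Rightarrow> bool" where
  "has_signature V b r s \<longleftrightarrow>
     (\<exists>e. inj_on e {..<r + s} \<and> independent (e ` {..<r + s}) \<and> span (e ` {..<r + s}) = V \<and>
        (\<forall>i<r + s. \<forall>j<r + s. b (e i) (e j) = (if i \<noteq> j then 0 else if i < r then 1 else - 1)))"

definition pseudo_riemannian_metric ::
    "('a::topological_space, 'e::euclidean_space) chart set \<Rightarrow> 'a form2 \<Rightarrow> nat \<Rightarrow> nat \<Rightarrow> bool" where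
  "pseudo_riemannian_metric A g r s \<longleftrightarrow>
     (\<forall>p. \<forall>u\<in>tangent_space A p. linear_on (tangent_space A p) (g p u)) \<and>
     (\<forall>p. \<forall>u\<in>tangent_space A p. \<forall>v\<in>tangent_space A p. g p u v = g p v u) \<and>
     (\<forall>p. has_signature (tangent_space A p) (g p) r s) \<and>
     (\<forall>X\<in>vector_fields A. \<forall>Y\<in>vector_fields A. (\<lambda>p. g p (X p) (Y p)) \<in> smooth_functions A)"


subsection \<open>Differentiation\<close>

definition affine_connection ::
    "('a::topological_space, 'e::euclidean_space) chart set \<Rightarrow>
     ('a vfield \<Rightarrow> 'a vfield \<Rightarrow> 'a vfield) \<Rightarrow> bool" where
  "affine_connection A D \<longleftrightarrow>
     (\<forall>X\<in>vector_fields A. \<forall>Y\<in>vector_fields A. D X Y \<in> vector_fields A) \<and>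
     (\<forall>X\<in>vector_fields A. \<forall>X'\<in>vector_fields A. \<forall>Y\<in>vector_fields A.
        D (X + X') Y = D X Y + D X' Y) \<and>
     (\<forall>f\<in>smooth_functions A. \<forall>X\<in>vector_fields A. \<forall>Y\<in>vector_fields A.
        D (fscale f X) Y = fscale f (D X Y)) \<and>
     (\<forall>X\<in>vector_fields A. \<forall>Y\<in>vector_fields A. \<forall>Y'\<in>vector_fields A.
        D X (Y + Y') = D X Y + D X Y') \<and>
     (\<forall>f\<in>smooth_functions A. \<forall>X\<in>vector_fields A. \<forall>Y\<in>vector_fields A.
        D X (fscale f Y) = fscale (\<lambda>p. X p f) Y + fscale f (D X Y))"

definition levi_civita_connection ::
    "('a::topological_space, 'e::euclidean_space) chart set \<Rightarrow> 'a form2 \<Rightarrow>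
     ('a vfield \<Rightarrow> 'a vfield \<Rightarrow> 'a vfield) \<Rightarrow> bool" where
  "levi_civita_connection A g D \<longleftrightarrow>
     affine_connection A D \<and>
     (\<forall>X\<in>vector_fields A. \<forall>Y\<in>vector_fields A. D X Y - D Y X = lie_bracket X Y) \<and>
     (\<forall>X\<in>vector_fields A. \<forall>Y\<in>vector_fields A. \<forall>Z\<in>vector_fields A. \<forall>p.
        X p (\<lambda>q. g q (Y q) (Z q)) = g p (D X Y p) (Z p) + g p (Y p) (D X Z p))"

definition lie_derivative11 :: "'a vfield \<Rightarrow> 'a tensor11 \<Rightarrow> 'a vfield \<Rightarrow> 'a vfield" where
  "lie_derivative11 X T Y = lie_bracket X (app11 T Y) - app11 T (lie_bracket X Y)"

text \<open>Forms are evaluated on vector fields, and \<open>d\<close> and \<open>\<and>\<close> carry no factorial factors: for a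
  torsion-free connection \<open>\<nabla>\<close>, \<open>ext_d2 \<omega>\<close> is the cyclic sum of \<open>(\<nabla>\<^sub>X \<omega>)(Y, Z)\<close>, and \<open>wedge12 \<theta> \<omega>\<close> is
  the cyclic sum of \<open>\<theta>(X) \<omega>(Y, Z)\<close>.\<close>

definition ext_d1 :: "'a form1 \<Rightarrow> 'a vfield \<Rightarrow> 'a vfield \<Rightarrow> 'a \<Rightarrow> real" where
  "ext_d1 \<theta> X Y = (\<lambda>p. X p (\<lambda>q. \<theta> q (Y q)) - Y p (\<lambda>q. \<theta> q (X q)) - \<theta> p (lie_bracket X Y p))"

definition ext_d2 :: "'a form2 \<Rightarrow> 'a vfield \<Rightarrow> 'a vfield \<Rightarrow> 'a vfield \<Rightarrow> 'a \<Rightarrow> real" where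
  "ext_d2 \<omega> X Y Z = (\<lambda>p.
     X p (\<lambda>q. \<omega> q (Y q) (Z q)) + Y p (\<lambda>q. \<omega> q (Z q) (X q)) + Z p (\<lambda>q. \<omega> q (X q) (Y q))
     - \<omega> p (lie_bracket X Y p) (Z p) - \<omega> p (lie_bracket Y Z p) (X p)
     - \<omega> p (lie_bracket Z X p) (Y p))"

definition wedge12 ::
    "'a form1 \<Rightarrow> 'a form2 \<Rightarrow> 'a vfield \<Rightarrow> 'a vfield \<Rightarrow> 'a vfield \<Rightarrow> 'a \<Rightarrow> real" where
  "wedge12 \<theta> \<omega> X Y Z = (\<lambda>p.
     \<theta> p (X p) * \<omega> p (Y p) (Z p) + \<theta> p (Y p) * \<omega> p (Z p) (X p) + \<theta> p (Z p) * \<omega> p (X p) (Y p))"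


subsection \<open>Almost paracontact metric structures\<close>

definition almost_paracontact_metric ::
    "nat \<Rightarrow> ('a::{t2_space, second_countable_topology}, 'e::euclidean_space) chart set \<Rightarrow>
     'a tensor11 \<Rightarrow> 'a vfield \<Rightarrow> 'a form1 \<Rightarrow> 'a form2 \<Rightarrow> bool" where
  "almost_paracontact_metric n A \<phi> \<xi> \<eta> g \<longleftrightarrow>
     smooth_atlas A \<and> DIM('e) = 2 * n + 1 \<and>
     is_tensor11 A \<phi> \<and> \<xi> \<in> vector_fields A \<and> is_form1 A \<eta> \<and>
     pseudo_riemannian_metric A g (n + 1) n \<and>
     (\<forall>p. \<eta> p (\<xi> p) = 1) \<and>
     (\<forall>p. \<forall>v\<in>tangent_space A p. \<phi> p (\<phi> p v) = v - \<eta> p v *\<^sub>R \<xi> p) \<and>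
     (\<forall>p. dim {v \<in> tangent_space A p. \<eta> p v = 0 \<and> \<phi> p v = v} = n) \<and>
     (\<forall>p. dim {v \<in> tangent_space A p. \<eta> p v = 0 \<and> \<phi> p v = - v} = n) \<and>
     (\<forall>p. \<forall>u\<in>tangent_space A p. \<forall>v\<in>tangent_space A p.
        g p (\<phi> p u) (\<phi> p v) = - g p u v + \<eta> p u * \<eta> p v)"

definition fundamental_form :: "'a tensor11 \<Rightarrow> 'a form2 \<Rightarrow> 'a form2"
  where "fundamental_form \<phi> g = (\<lambda>p u v. g p (\<phi> p u) v)"

definition almost_paracosymplectic ::
    "nat \<Rightarrow> ('a::{t2_space, second_countable_topology}, 'e::euclidean_space) chart set \<Rightarrow>
     ('a \<Rightarrow> real) \<Rightarrow> 'a tensor11 \<Rightarrow> 'a vfield \<Rightarrow> 'a form1 \<Rightarrow> 'a form2 \<Rightarrow> bool" where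
  "almost_paracosymplectic n A \<alpha> \<phi> \<xi> \<eta> g \<longleftrightarrow>
     almost_paracontact_metric n A \<phi> \<xi> \<eta> g \<and> \<alpha> \<in> smooth_functions A \<and>
     (\<forall>X\<in>vector_fields A. \<forall>Y\<in>vector_fields A. \<forall>p. ext_d1 \<eta> X Y p = 0) \<and>
     (\<forall>X\<in>vector_fields A. \<forall>Y\<in>vector_fields A. \<forall>Z\<in>vector_fields A. \<forall>p.
        ext_d2 (fundamental_form \<phi> g) X Y Z p
        = 2 * \<alpha> p * wedge12 \<eta> (fundamental_form \<phi> g) X Y Z p)"

definition h_tensor :: "'a tensor11 \<Rightarrow> 'a vfield \<Rightarrow> 'a vfield \<Rightarrow> 'a vfield"
  where "h_tensor \<phi> \<xi> X = (1 / 2) *\<^sub>R lie_derivative11 \<xi> \<phi> X"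

definition A_tensor ::
    "('a vfield \<Rightarrow> 'a vfield \<Rightarrow> 'a vfield) \<Rightarrow> 'a vfield \<Rightarrow> 'a vfield \<Rightarrow> 'a vfield"
  where "A_tensor D \<xi> X = - D X \<xi>"

end

theory Submission
  imports Defs
begin

text \<open>Write \<open>N X = \<nabla>\<^sub>X \<xi>\<close>. The proof reduces everything to two properties of \<open>N\<close> and one formula for \<open>h\<close>.

  Since \<open>\<eta>\<close> is the metric dual of \<open>\<xi>\<close>, closedness of \<open>\<eta>\<close> means that \<open>N\<close> is self-adjoint
  (\<open>nabla_xi_self_adjoint\<close>), and \<open>g(\<xi>, \<xi>) = 1\<close> then forces \<open>N \<xi> = 0\<close> (\<open>nabla_xi_xi\<close>). Contracting
  \<open>d\<Phi> = 2\<alpha> \<eta>\<and>\<Phi>\<close> with \<open>\<xi>\<close> shows that the Lie derivative of \<open>\<Phi> = g(\<phi>\<cdot>, \<cdot>)\<close> along \<open>\<xi>\<close> is \<open>2\<alpha>\<Phi>\<close>; expanding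
  it by the product rule, where \<open>\<phi>\<close> contributes \<open>2h\<close> and \<open>g\<close> contributes \<open>2N\<close>, gives
  \<open>h = \<alpha>\<phi> - N \<circ> \<phi>\<close> (\<open>g_h\<close>, \<open>h_eq\<close>). In particular \<open>h \<xi> = 0\<close>. The Lie derivative of
  \<open>\<phi>\<^sup>2 = Id - \<eta> \<otimes> \<xi>\<close> along \<open>\<xi>\<close> vanishes because that of \<open>\<eta>\<close> does, and this is the anticommutation of \<open>h\<close>
  and \<open>\<phi>\<close> (\<open>h_phi_anticommute\<close>). Composing the formula for \<open>h\<close> with \<open>\<phi>\<close> and anticommuting gives
  \<open>N = \<alpha>\<phi>\<^sup>2 + \<phi> \<circ> h\<close> (\<open>phi_h_eq\<close>). Because \<open>\<phi>\<^sup>3 = \<phi>\<close>, also \<open>h = h \<circ> \<phi>\<^sup>2 = - \<phi> \<circ> h \<circ> \<phi>\<close>, which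
  yields the second formula \<open>h = \<phi> \<circ> N - \<alpha>\<phi>\<close>. It is the adjoint of the first, so that \<open>h\<close> is self-adjoint (\<open>h_self_adjoint\<close>). Brackets never have to be
  computed: by torsion-freeness they are differences of covariant derivatives.

  These computations produce inner products with vector fields. To conclude equality of vector fields one
  needs that a tangent vector orthogonal to the values of all vector fields is zero
  (\<open>metric_nondegenerate_on_vector_fields\<close>). Vector fields and the functions they act on are defined on the
  whole manifold, so local coordinates have to be globalized: coordinate fields of a chart, cut off by a smooth bump function.
  Their values at a given point are independent because they are dual to cut-off coordinate functions, and
  their number is the dimension prescribed by the signature, so they form a basis of the tangent space.\<close>

section \<open>Calculus of \<open>C\<close>-\<open>k\<close> maps on open sets\<close>

lemma Ck_on_has_derivative:
  assumes "open S" "Ck_on (Suc k) S f" "x \<in> S"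
  shows "(f has_derivative frechet_derivative f (at x)) (at x)"
  using assms by (simp add: differentiable_on_eq_differentiable_at frechet_derivative_works[symmetric])

lemma Ck_on_cong:
  assumes "open S" and "\<And>x. x \<in> S \<Longrightarrow> f x = g x" and "Ck_on k S f"
  shows "Ck_on k S g"
  using assms(2,3)
proof (induction k arbitrary: f g)
  case 0
  then show ?case by (metis Ck_on.simps(1) continuous_on_cong)
next
  case (Suc k)
  have D: "(g has_derivative frechet_derivative f (at x)) (at x)" if "x \<in> S" for x
    using has_derivative_transform_within_open[OF Ck_on_has_derivative[OF assms(1) Suc.prems(2) that] assms(1) that]
      Suc.prems(1) by blast
  have "Ck_on k S (\<lambda>x. frechet_derivative g (at x) v)" for v
    by (rule Suc.IH[of "\<lambda>x. frechet_derivative f (at x) v"])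
      (use Suc.prems(2) D frechet_derivative_at in force)+
  moreover have "g differentiable_on S"
    using assms(1) D differentiable_on_eq_differentiable_at differentiable_def by blast
  ultimately show ?case by simp
qed

text \<open>The recursion defining \<open>Ck_on\<close> mentions the choice operator \<open>frechet_derivative\<close>; this
  introduction rule accepts any explicit formula for the derivative instead, which is how sums,
  products and composites are handled below.\<close>

lemma Ck_on_SucI:
  assumes "open S" and D: "\<And>x. x \<in> S \<Longrightarrow> (f has_derivative D x) (at x)"
    and "\<And>v. Ck_on k S (\<lambda>x. D x v)"
  shows "Ck_on (Suc k) S f"
proof -
  have "Ck_on k S (\<lambda>x. frechet_derivative f (at x) v)" for v
    by (rule Ck_on_cong[OF assms(1) _ assms(3)[of v]]) (use D frechet_derivative_at in metis)
  moreover have "f differentiable_on S"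
    using assms(1) D differentiable_on_eq_differentiable_at differentiable_def by blast
  ultimately show ?thesis by simp
qed

lemma Ck_on_Suc_D: "Ck_on (Suc k) S f \<Longrightarrow> Ck_on k S f"
proof (induction k arbitrary: f)
  case 0
  then show ?case by (simp add: differentiable_imp_continuous_on)
next
  case (Suc k)
  then show ?case by (metis Ck_on.simps(2))
qed

lemma Ck_on_subset: "Ck_on k S f \<Longrightarrow> T \<subseteq> S \<Longrightarrow> Ck_on k T f"
proof (induction k arbitrary: f)
  case 0
  then show ?case using continuous_on_subset by auto
next
  case (Suc k)
  then show ?case using differentiable_on_subset by auto
qed

lemma Ck_on_local:
  assumes "open S" "\<And>x. x \<in> S \<Longrightarrow> \<exists>T. open T \<and> x \<in> T \<and> Ck_on k T f"
  shows "Ck_on k S f"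
  using assms(2)
proof (induction k arbitrary: f)
  case 0
  have "continuous (at x) f" if "x \<in> S" for x
    using 0[OF that] by (auto simp: continuous_on_eq_continuous_at)
  then show ?case
    by (simp add: continuous_at_imp_continuous_on)
next
  case (Suc k)
  have "f differentiable (at x)" if "x \<in> S" for x
    using Suc.prems[OF that] by (auto simp: differentiable_on_eq_differentiable_at)
  moreover have "Ck_on k S (\<lambda>x. frechet_derivative f (at x) v)" for v
    by (rule Suc.IH) (use Suc.prems in fastforce)
  ultimately show ?case
    by (simp add: differentiable_at_imp_differentiable_on)
qed

lemma Ck_on_const: "Ck_on k S (\<lambda>x. a)"
  by (induction k arbitrary: a) simp_all

lemma Ck_on_bounded_linear:
  assumes "open S" "bounded_linear L"
  shows "Ck_on k S L"
proof (cases k)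
  case 0
  then show ?thesis using assms by (simp add: linear_continuous_on)
next
  case (Suc j)
  show ?thesis unfolding Suc
    by (rule Ck_on_SucI[OF assms(1), of L "\<lambda>_. L"])
      (use assms(2) Ck_on_const bounded_linear_imp_has_derivative in auto)
qed

text \<open>The chain rule for a linear outer map needs no expansion of the derivative in a basis. It is
  proved first because the general chain rule relies on it for the coordinates of the inner
  derivative.\<close>

lemma Ck_on_linear_image:
  assumes "open S" "bounded_linear L" "Ck_on k S f"
  shows "Ck_on k S (\<lambda>x. L (f x))"
  using assms(3)
proof (induction k arbitrary: f)
  case 0
  then show ?case using assms(2) by (simp add: bounded_linear.continuous_on)
next
  case (Suc k)
  show ?case
  proof (rule Ck_on_SucI[OF assms(1)])
    show "((\<lambda>x. L (f x)) has_derivative (\<lambda>v. L (frechet_derivative f (at x) v))) (at x)" if "x \<in> S" for x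
      by (rule bounded_linear.has_derivative[OF assms(2) Ck_on_has_derivative[OF assms(1) Suc.prems that]])
  qed (use Suc in simp)
qed

lemma Ck_on_add:
  assumes "open S" "Ck_on k S f" "Ck_on k S g"
  shows "Ck_on k S (\<lambda>x. f x + g x)"
  using assms(2,3)
proof (induction k arbitrary: f g)
  case 0
  then show ?case by (simp add: continuous_on_add)
next
  case (Suc k)
  show ?case
  proof (rule Ck_on_SucI[OF assms(1)])
    show "((\<lambda>x. f x + g x) has_derivative
        (\<lambda>v. frechet_derivative f (at x) v + frechet_derivative g (at x) v)) (at x)" if "x \<in> S" for x
      by (rule has_derivative_add[OF Suc.prems[THEN Ck_on_has_derivative[OF assms(1) _ that]]])
  qed (use Suc in auto)
qed

lemma Ck_on_sum:
  assumes "open S" "\<And>i. i \<in> I \<Longrightarrow> Ck_on k S (f i)"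
  shows "Ck_on k S (\<lambda>x. \<Sum>i\<in>I. f i x)"
  using assms(2)
  by (induction I rule: infinite_finite_induct) (auto simp: Ck_on_const intro: Ck_on_add[OF assms(1)])

lemma Ck_on_scaleR:
  fixes f :: "'e::euclidean_space \<Rightarrow> real"
  assumes "open S" "Ck_on k S f" "Ck_on k S g"
  shows "Ck_on k S (\<lambda>x. f x *\<^sub>R g x)"
  using assms(2,3)
proof (induction k arbitrary: f g)
  case 0
  then show ?case by (simp add: continuous_on_scaleR)
next
  case (Suc k)
  show ?case
  proof (rule Ck_on_SucI[OF assms(1)])
    show "((\<lambda>x. f x *\<^sub>R g x) has_derivative
        (\<lambda>v. f x *\<^sub>R frechet_derivative g (at x) v + frechet_derivative f (at x) v *\<^sub>R g x)) (at x)"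
      if "x \<in> S" for x
      by (rule has_derivative_scaleR[OF Suc.prems[THEN Ck_on_has_derivative[OF assms(1) _ that]]])
    show "Ck_on k S (\<lambda>x. f x *\<^sub>R frechet_derivative g (at x) v + frechet_derivative f (at x) v *\<^sub>R g x)" for v
      using Suc.prems Suc.prems[THEN Ck_on_Suc_D] by (intro Ck_on_add[OF assms(1)] Suc.IH) simp_all
  qed
qed

text \<open>Writing the derivative of the composite as a finite sum of products of a coordinate of the
  inner derivative with a partial derivative of \<open>g\<close>, composed with \<open>f\<close>, makes each factor a map to
  which the induction hypothesis or the product rule applies.\<close>

lemma Ck_on_compose:
  fixes f :: "'d::euclidean_space \<Rightarrow> 'e::euclidean_space" and g :: "'e \<Rightarrow> 'b::euclidean_space"
  assumes "open S" "open T" "f ` S \<subseteq> T" "Ck_on k S f" "Ck_on k T g"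
  shows "Ck_on k S (\<lambda>x. g (f x))"
  using assms(4,5)
proof (induction k arbitrary: g)
  case 0
  then show ?case using assms(3) continuous_on_compose2[of T g S f] by simp
next
  case (Suc k)
  let ?f' = "\<lambda>x. frechet_derivative f (at x)" and ?g' = "\<lambda>y. frechet_derivative g (at y)"
  show ?case
  proof (rule Ck_on_SucI[OF assms(1)])
    show "((\<lambda>x. g (f x)) has_derivative (\<lambda>v. \<Sum>b\<in>Basis. (?f' x v \<bullet> b) *\<^sub>R ?g' (f x) b)) (at x)"
      if x: "x \<in> S" for x
    proof -
      have g: "(g has_derivative ?g' (f x)) (at (f x))"
        using Ck_on_has_derivative[OF assms(2) Suc.prems(2)] assms(3) x by blast
      have "linear (?g' (f x))"
        using g has_derivative_linear by blast
      then have "?g' (f x) (\<Sum>b\<in>Basis. (w \<bullet> b) *\<^sub>R b) = (\<Sum>b\<in>Basis. (w \<bullet> b) *\<^sub>R ?g' (f x) b)" for w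
        by (simp add: linear_sum linear_scale del: euclidean_representation)
      then have "(\<lambda>v. ?g' (f x) (?f' x v)) = (\<lambda>v. \<Sum>b\<in>Basis. (?f' x v \<bullet> b) *\<^sub>R ?g' (f x) b)"
        unfolding euclidean_representation by blast
      then show ?thesis
        using has_derivative_compose[OF Ck_on_has_derivative[OF assms(1) Suc.prems(1) x] g] by metis
    qed
    show "Ck_on k S (\<lambda>x. \<Sum>b\<in>Basis. (?f' x v \<bullet> b) *\<^sub>R ?g' (f x) b)" for v
    proof (intro Ck_on_sum Ck_on_scaleR assms(1))
      fix b :: 'e
      have f': "Ck_on k S (\<lambda>x. ?f' x v)"
        using Suc.prems(1) by simp
      show "Ck_on k S (\<lambda>x. ?f' x v \<bullet> b)"
        by (rule Ck_on_linear_image[OF assms(1) bounded_linear_inner_left f'])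
      show "Ck_on k S (\<lambda>x. ?g' (f x) b)"
        using Suc.IH[OF Suc.prems(1)[THEN Ck_on_Suc_D], of "\<lambda>y. ?g' y b"] Suc.prems(2) by simp
    qed
  qed
qed

lemma smooth_onI: "(\<And>k. Ck_on k S f) \<Longrightarrow> smooth_on S f"
  and smooth_onD: "smooth_on S f \<Longrightarrow> Ck_on k S f"
  by (simp_all add: smooth_on_def)

lemma smooth_on_const: "smooth_on S (\<lambda>x. a)"
  by (simp add: smooth_on_def Ck_on_const)

lemma smooth_on_add: "open S \<Longrightarrow> smooth_on S f \<Longrightarrow> smooth_on S g \<Longrightarrow> smooth_on S (\<lambda>x. f x + g x)"
  by (simp add: smooth_on_def Ck_on_add)

lemma smooth_on_mult:
  fixes f g :: "'e::euclidean_space \<Rightarrow> real"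
  shows "open S \<Longrightarrow> smooth_on S f \<Longrightarrow> smooth_on S g \<Longrightarrow> smooth_on S (\<lambda>x. f x * g x)"
  using Ck_on_scaleR[of S _ f g] by (simp add: smooth_on_def)

lemma smooth_on_frechet_derivative:
  "smooth_on S f \<Longrightarrow> smooth_on S (\<lambda>x. frechet_derivative f (at x) v)"
  unfolding smooth_on_def by (metis Ck_on.simps(2))

lemma smooth_on_has_derivative:
  "open S \<Longrightarrow> smooth_on S f \<Longrightarrow> x \<in> S \<Longrightarrow> (f has_derivative frechet_derivative f (at x)) (at x)"
  unfolding smooth_on_def using Ck_on_has_derivative by blast

section \<open>Smooth bump functions\<close>

text \<open>\<open>flat 0\<close> is the classical smooth function that is flat at 0. The powers of \<open>inverse x\<close> are
  carried along because the family \<open>flat m\<close> is then closed under differentiation up to linear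
  combinations, so that all derivatives are treated by one induction.\<close>

definition flat :: "nat \<Rightarrow> real \<Rightarrow> real"
  where "flat m x = (if x > 0 then inverse x ^ m / exp (inverse x) else 0)"

text \<open>With \<open>y = inverse x\<close> the limit from the right is that of \<open>y ^ m / exp y\<close> at infinity. As the
  difference quotient of \<open>flat m\<close> at 0 is \<open>flat (m + 1)\<close>, this limit also gives the derivative there.\<close>

lemma flat_tendsto_0: "(flat m \<longlongrightarrow> 0) (at 0)"
proof -
  have "((\<lambda>x. inverse x ^ m / exp (inverse x)) \<longlongrightarrow> (0::real)) (at_right 0)"
    by (rule filterlim_compose[OF tendsto_power_div_exp_0 filterlim_inverse_at_top_right])
  then have "(flat m \<longlongrightarrow> 0) (at_right 0)"
    by (rule Lim_transform_eventually) (auto simp: flat_def eventually_at_filter)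
  moreover have "(flat m \<longlongrightarrow> 0) (at_left 0)"
    by (rule Lim_transform_eventually[OF tendsto_const]) (auto simp: flat_def eventually_at_filter)
  ultimately show ?thesis
    using filterlim_split_at by blast
qed

lemma flat_has_real_derivative:
  "(flat m has_real_derivative flat (m + 2) x - m * flat (m + 1) x) (at x)"
proof (cases x "0::real" rule: linorder_cases)
  case less
  have "((\<lambda>_. 0) has_real_derivative 0) (at x)"
    by simp
  then have "(flat m has_real_derivative 0) (at x)"
    by (rule has_field_derivative_transform_within_open[of _ _ _ "{..<0}"]) (use less in \<open>auto simp: flat_def\<close>)
  then show ?thesis
    using less by (simp add: flat_def)
next
  case equal
  have "((\<lambda>h. (flat m (0 + h) - flat m 0) / h) \<longlongrightarrow> 0) (at 0)"
    by (rule Lim_transform_eventually[OF flat_tendsto_0[of "m + 1"]])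
      (auto simp: flat_def field_simps eventually_at_filter)
  then have "(flat m has_real_derivative 0) (at 0)"
    by (simp add: DERIV_def)
  then show ?thesis
    using equal by (simp add: flat_def)
next
  case greater
  \<comment> \<open>The closed form is differentiated as a function of \<open>y = inverse x\<close>, where only \<open>m - 1\<close> at
    \<open>m = 0\<close> calls for a case distinction.\<close>
  let ?y = "inverse x"
  have "((\<lambda>y. y ^ m / exp y) has_real_derivative (m * ?y ^ (m - 1) - ?y ^ m) / exp ?y) (at ?y)"
    by (auto intro!: derivative_eq_intros simp: field_simps power2_eq_square)
  moreover have "(inverse has_real_derivative - (?y\<^sup>2)) (at x)"
    using DERIV_inverse[of x] greater by (simp add: power2_eq_square)
  ultimately have "((\<lambda>x. inverse x ^ m / exp (inverse x)) has_real_derivative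
      (m * ?y ^ (m - 1) - ?y ^ m) / exp ?y * - (?y\<^sup>2)) (at x)"
    by (rule DERIV_chain2)
  moreover have "(m * y ^ (m - 1) - y ^ m) / exp y * - (y\<^sup>2) = y ^ (m + 2) / exp y - m * (y ^ (m + 1) / exp y)"
    for y :: real
    by (cases m) (simp_all add: field_simps power2_eq_square)
  ultimately have "((\<lambda>x. inverse x ^ m / exp (inverse x)) has_real_derivative
      flat (m + 2) x - m * flat (m + 1) x) (at x)"
    using greater by (simp add: flat_def)
  then show ?thesis
    by (rule has_field_derivative_transform_within_open[of _ _ _ "{0<..}"]) (use greater in \<open>auto simp: flat_def\<close>)
qed

lemma smooth_on_flat: "smooth_on UNIV (flat m)"
proof (rule smooth_onI)
  show "Ck_on k UNIV (flat m)" for k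
  proof (induction k arbitrary: m)
    case 0
    then show ?case
      using has_real_derivative_imp_continuous_on[OF flat_has_real_derivative] by simp
  next
    case (Suc k)
    show ?case
    proof (rule Ck_on_SucI[OF open_UNIV])
      show "(flat m has_derivative (\<lambda>v. v * (flat (m + 2) x + (- real m) * flat (m + 1) x))) (at x)" for x
        using flat_has_real_derivative[of m x] by (simp add: has_field_derivative_def mult_commute_abs)
      show "Ck_on k UNIV (\<lambda>x. v * (flat (m + 2) x + (- real m) * flat (m + 1) x))" for v
        unfolding real_scaleR_def[symmetric]
        by (intro Ck_on_scaleR Ck_on_add Ck_on_const open_UNIV Suc.IH)
    qed
  qed
qed

text \<open>Compose the flat function with \<open>r\<^sup>2 - (dist x a)\<^sup>2\<close>, where the closed ball of radius \<open>r\<close> about \<open>a\<close> lies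
  in \<open>S\<close>; this ball serves as \<open>K\<close>.\<close>

lemma smooth_bump_exists:
  fixes a :: "'e::euclidean_space"
  assumes "open S" "a \<in> S"
  obtains \<beta> :: "'e \<Rightarrow> real" and K
  where "smooth_on UNIV \<beta>" "compact K" "K \<subseteq> S" "\<beta> a \<noteq> 0" "{x. \<beta> x \<noteq> 0} \<subseteq> K"
proof -
  obtain r where r: "r > 0" "cball a r \<subseteq> S"
    using assms open_contains_cball by blast
  define q where "q x = r\<^sup>2 + (\<Sum>b\<in>Basis. - ((x - a) \<bullet> b) * ((x - a) \<bullet> b))" for x
  have q: "q x = r\<^sup>2 - (dist x a)\<^sup>2" for x
    by (simp add: q_def sum_negf dist_norm power2_norm_eq_inner flip: euclidean_inner)
  have lin: "Ck_on k UNIV (\<lambda>x. (x - a) \<bullet> b)" for k and b :: 'e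
    using Ck_on_add[OF open_UNIV Ck_on_bounded_linear[OF open_UNIV bounded_linear_inner_left, of k b] Ck_on_const[of k _ "- (a \<bullet> b)"]]
    by (simp add: inner_diff_left)
  have minus: "Ck_on k UNIV (\<lambda>x. - ((x - a) \<bullet> b))" for k and b :: 'e
    by (rule Ck_on_linear_image[OF open_UNIV _ lin]) (simp add: bounded_linear_minus bounded_linear_ident)
  have "Ck_on k UNIV (\<lambda>x. - ((x - a) \<bullet> b) * ((x - a) \<bullet> b))" for k and b :: 'e
    using Ck_on_scaleR[OF open_UNIV minus lin] by simp
  then have "Ck_on k UNIV q" for k
    unfolding q_def by (intro Ck_on_add Ck_on_const Ck_on_sum open_UNIV)
  then have smooth: "smooth_on UNIV (\<lambda>x. flat 0 (q x))"
    by (intro smooth_onI Ck_on_compose[OF open_UNIV open_UNIV _ _ smooth_onD[OF smooth_on_flat]]) auto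
  have "flat 0 (q x) = 0" if "x \<notin> cball a r" for x
  proof -
    have "r\<^sup>2 \<le> (dist x a)\<^sup>2"
      by (rule power_mono) (use that r(1) in \<open>auto simp: dist_commute\<close>)
    then show ?thesis
      by (simp add: flat_def q)
  qed
  then have "{x. flat 0 (q x) \<noteq> 0} \<subseteq> cball a r"
    by blast
  moreover have "flat 0 (q a) \<noteq> 0"
    using r(1) by (simp add: flat_def q)
  ultimately show thesis
    using smooth that[OF _ compact_cball r(2)] by blast
qed

section \<open>Vector fields supported in a chart\<close>

lemma atlas_chart:
  assumes "smooth_atlas A" "(U, c) \<in> A"
  shows "open U" "open (c ` U)" "homeomorphism U (c ` U) c (inv_into U c)"
  using assms by (force simp: smooth_atlas_def is_chart_def)+

lemma chart_image_open:
  assumes "smooth_atlas A" "(U, c) \<in> A" "open W" "W \<subseteq> U"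
  shows "open (c ` W)"
proof -
  have "openin (top_of_set U) W"
    using assms(3,4) by (simp add: openin_open_eq atlas_chart[OF assms(1,2)])
  then show ?thesis
    using homeomorphism_imp_open_map[OF atlas_chart(3)[OF assms(1,2)]] openin_open_trans atlas_chart(2)[OF assms(1,2)]
    by blast
qed

definition extend_by_zero :: "'a set \<Rightarrow> ('a \<Rightarrow> 'e) \<Rightarrow> ('e \<Rightarrow> real) \<Rightarrow> 'a \<Rightarrow> real"
  where "extend_by_zero U c \<beta> p = (if p \<in> U then \<beta> (c p) else 0)"

text \<open>The preimage of \<open>K\<close> in the manifold is compact, hence closed because the manifold is Hausdorff. So
  the manifold is covered by the two open sets \<open>U\<close>, on which the function is smooth by the smoothness
  of the transition maps, and the complement of that preimage, on which it vanishes.\<close>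

lemma extend_by_zero_smooth:
  fixes A :: "('a::{t2_space, second_countable_topology}, 'e::euclidean_space) chart set"
  assumes A: "smooth_atlas A" and U: "(U, c) \<in> A"
    and \<beta>: "smooth_on (c ` U) \<beta>" and K: "compact K" "K \<subseteq> c ` U"
    and supp: "\<And>x. x \<notin> K \<Longrightarrow> \<beta> x = 0"
  shows "extend_by_zero U c \<beta> \<in> smooth_functions A"
  unfolding smooth_functions_def
proof clarify
  fix V d assume V: "(V, d) \<in> A"
  let ?i = "inv_into U c" and ?j = "inv_into V d"
  note U' = atlas_chart[OF A U] and V' = atlas_chart[OF A V]
  have ic: "?i (c p) = p" if "p \<in> U" for p
    using U'(3) that homeomorphism_apply1 by metis
  have jd: "?j (d p) = p" if "p \<in> V" for p
    using V'(3) that homeomorphism_apply1 by metis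
  have "closed (?i ` K)"
    using U'(3) K
    by (intro compact_imp_closed compact_continuous_image) (auto simp: homeomorphism_def intro: continuous_on_subset)
  then have outside: "open (d ` (V - ?i ` K))"
    by (intro chart_image_open[OF A V] open_Diff V'(1)) auto
  have inside: "open (d ` (V \<inter> U))"
    by (intro chart_image_open[OF A V] open_Int V'(1) U'(1)) auto
  show "smooth_on (d ` V) (extend_by_zero U c \<beta> \<circ> ?j)"
  proof (rule smooth_onI, rule Ck_on_local[OF V'(2)])
    fix k y assume "y \<in> d ` V"
    then obtain p where p: "p \<in> V" "y = d p" by blast
    show "\<exists>T. open T \<and> y \<in> T \<and> Ck_on k T (extend_by_zero U c \<beta> \<circ> ?j)"
    proof (cases "p \<in> U")
      case True
      have "smooth_on (d ` (V \<inter> U)) (c \<circ> ?j)"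
        using A U V unfolding smooth_atlas_def by blast
      then have "Ck_on k (d ` (V \<inter> U)) (\<lambda>y. \<beta> (c (?j y)))"
        by (intro Ck_on_compose[OF inside U'(2) _ _ smooth_onD[OF \<beta>]] smooth_onD)
          (auto simp: jd comp_def)
      then have "Ck_on k (d ` (V \<inter> U)) (extend_by_zero U c \<beta> \<circ> ?j)"
        by (rule Ck_on_cong[OF inside, rotated]) (auto simp: jd extend_by_zero_def)
      then show ?thesis
        using inside p True by blast
    next
      case False
      have "\<beta> (c q) = 0" if "q \<in> U" "q \<notin> ?i ` K" for q
        using that ic supp by (metis imageI)
      then have "Ck_on k (d ` (V - ?i ` K)) (extend_by_zero U c \<beta> \<circ> ?j)"
        by (intro Ck_on_cong[OF outside _ Ck_on_const[of _ _ 0]]) (auto simp: jd extend_by_zero_def)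
      moreover have "p \<notin> ?i ` K"
        using False K(2) ic by (auto dest!: subsetD)
      ultimately show ?thesis
        using outside p by blast
    qed
  qed
qed

lemma smooth_functions_chart:
  "f \<in> smooth_functions A \<Longrightarrow> (U, c) \<in> A \<Longrightarrow> smooth_on (c ` U) (f \<circ> inv_into U c)"
  by (auto simp: smooth_functions_def)

lemma smooth_functions_add:
  assumes "smooth_atlas A" "f \<in> smooth_functions A" "g \<in> smooth_functions A"
  shows "(\<lambda>p. f p + g p) \<in> smooth_functions A"
  using assms smooth_on_add[OF atlas_chart(2)[OF assms(1)]]
  by (fastforce simp: smooth_functions_def comp_def)

lemma smooth_functions_mult:
  assumes "smooth_atlas A" "f \<in> smooth_functions A" "g \<in> smooth_functions A"
  shows "(\<lambda>p. f p * g p) \<in> smooth_functions A"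
  using assms smooth_on_mult[OF atlas_chart(2)[OF assms(1)]]
  by (fastforce simp: smooth_functions_def comp_def)

lemma smooth_functions_const: "(\<lambda>p. a) \<in> smooth_functions A"
  by (auto simp: smooth_functions_def comp_def smooth_on_const)

text \<open>This is the coordinate field in the direction \<open>v\<close> multiplied by the cut-off function \<open>\<beta>\<close>, both
  read in the chart \<open>(U, c)\<close>. The value 0 on functions that are not smooth is the convention that
  makes the values elements of the tangent spaces.\<close>

definition cutoff_coordinate_field ::
    "('a::topological_space, 'e::euclidean_space) chart set \<Rightarrow> 'a set \<Rightarrow> ('a \<Rightarrow> 'e) \<Rightarrow> ('e \<Rightarrow> real) \<Rightarrow> 'e \<Rightarrow> 'a vfield"
  where "cutoff_coordinate_field A U c \<beta> v = (\<lambda>p f. if f \<in> smooth_functions A then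
    extend_by_zero U c (\<lambda>x. \<beta> x * frechet_derivative (f \<circ> inv_into U c) (at x) v) p else 0)"

text \<open>Pointwise this is the Leibniz rule for the Frechet derivative. The field maps a smooth function \<open>f\<close>
  to the extension by zero of \<open>\<beta>\<close> times a directional derivative of \<open>f\<close> in the chart, which is smooth
  because \<open>\<beta>\<close> has compact support.\<close>

lemma cutoff_coordinate_field_in_vector_fields:
  fixes A :: "('a::{t2_space, second_countable_topology}, 'e::euclidean_space) chart set"
  assumes A: "smooth_atlas A" and U: "(U, c) \<in> A"
    and \<beta>: "smooth_on (c ` U) \<beta>" and K: "compact K" "K \<subseteq> c ` U"
    and supp: "\<And>x. x \<notin> K \<Longrightarrow> \<beta> x = 0"
  shows "cutoff_coordinate_field A U c \<beta> v \<in> vector_fields A"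
proof -
  let ?i = "inv_into U c" and ?X = "cutoff_coordinate_field A U c \<beta> v"
  note U' = atlas_chart[OF A U]
  have ic: "?i (c p) = p" if "p \<in> U" for p
    using U'(3) that homeomorphism_apply1 by metis
  have D: "((\<lambda>x. f (?i x)) has_derivative frechet_derivative (\<lambda>x. f (?i x)) (at (c p))) (at (c p))"
    if "f \<in> smooth_functions A" "p \<in> U" for f p
    using smooth_on_has_derivative[OF U'(2) smooth_functions_chart[OF that(1) U]] that(2)
    by (simp add: comp_def)
  have X: "?X p f = \<beta> (c p) * D v"
    if "p \<in> U" "f \<in> smooth_functions A" "((\<lambda>x. f (?i x)) has_derivative D) (at (c p))" for p f D
    using that frechet_derivative_at[OF that(3)] by (simp add: cutoff_coordinate_field_def extend_by_zero_def comp_def)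
  have X0: "?X p f = 0" if "p \<notin> U" for p f
    using that by (simp add: cutoff_coordinate_field_def extend_by_zero_def)
  have "?X p \<in> tangent_space A p" for p
    unfolding tangent_space_def mem_Collect_eq
  proof (intro conjI allI ballI impI)
    fix f assume "f \<notin> smooth_functions A"
    then show "?X p f = 0" by (simp add: cutoff_coordinate_field_def)
  next
    fix f g assume fg: "f \<in> smooth_functions A" "g \<in> smooth_functions A"
    show "?X p (\<lambda>x. f x + g x) = ?X p f + ?X p g"
    proof (cases "p \<in> U")
      case True
      show ?thesis
        using X[of p "\<lambda>x. f x + g x", OF True smooth_functions_add[OF A fg]
            has_derivative_add[OF D[OF fg(1) True] D[OF fg(2) True]]]
          X[OF True fg(1) D[OF fg(1) True]] X[OF True fg(2) D[OF fg(2) True]]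
        by (simp add: distrib_left)
    qed (simp add: X0)
    show "?X p (\<lambda>x. f x * g x) = f p * ?X p g + g p * ?X p f"
    proof (cases "p \<in> U")
      case True
      show ?thesis
        using X[of p "\<lambda>x. f x * g x", OF True smooth_functions_mult[OF A fg]
            has_derivative_mult[OF D[OF fg(1) True] D[OF fg(2) True]]]
          X[OF True fg(1) D[OF fg(1) True]] X[OF True fg(2) D[OF fg(2) True]]
        by (simp add: algebra_simps ic[OF True])
    qed (simp add: X0)
  next
    fix a f assume f: "f \<in> smooth_functions A"
    show "?X p (\<lambda>x. a * f x) = a * ?X p f"
    proof (cases "p \<in> U")
      case True
      show ?thesis
        using X[of p "\<lambda>x. a * f x", OF True smooth_functions_mult[OF A smooth_functions_const f]
            has_derivative_mult_right[OF D[OF f True]]]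
          X[OF True f D[OF f True]]
        by simp
    qed (simp add: X0)
  qed
  moreover have "(\<lambda>p. ?X p f) \<in> smooth_functions A" if f: "f \<in> smooth_functions A" for f
  proof -
    have "extend_by_zero U c (\<lambda>x. \<beta> x * frechet_derivative (f \<circ> ?i) (at x) v) \<in> smooth_functions A"
      by (intro extend_by_zero_smooth[OF A U _ K] smooth_on_mult[OF U'(2) \<beta>] smooth_on_frechet_derivative
          smooth_functions_chart[OF f U]) (simp add: supp)
    then show ?thesis
      using f by (simp add: cutoff_coordinate_field_def)
  qed
  ultimately show ?thesis
    by (simp add: vector_fields_def)
qed

section \<open>Vector fields detect tangent vectors\<close>

lemma independent_dual_family:
  fixes u :: "'i \<Rightarrow> 'f \<Rightarrow> real"
  assumes "finite I" "c \<noteq> 0"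
    and dual: "\<And>i j. i \<in> I \<Longrightarrow> j \<in> I \<Longrightarrow> u i (y j) = (if i = j then c else 0)"
  shows "inj_on u I" "independent (u ` I)"
proof -
  show inj: "inj_on u I"
    using dual \<open>c \<noteq> 0\<close> by (metis inj_onI)
  show "independent (u ` I)"
  proof (rule independent_if_scalars_zero)
    fix a v assume 0: "(\<Sum>x\<in>u ` I. a x *\<^sub>R x) = 0" and "v \<in> u ` I"
    then obtain j where j: "j \<in> I" "v = u j" by blast
    have eval: "(\<Sum>i\<in>J. a (u i) *\<^sub>R u i) f = (\<Sum>i\<in>J. a (u i) * u i f)" for J f
      by (induction J rule: infinite_finite_induct) (simp_all add: scaleR_fun_def)
    have "0 = (\<Sum>i\<in>I. a (u i) *\<^sub>R u i) (y j)"
      using 0 inj by (simp add: sum.reindex)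
    also have "\<dots> = (\<Sum>i\<in>I. if i = j then a (u i) * c else 0)"
      unfolding eval using dual j(1) by (intro sum.cong) auto
    also have "\<dots> = a v * c"
      using j assms(1) by simp
    finally show "a v = 0"
      using \<open>c \<noteq> 0\<close> by simp
  qed (use assms(1) in simp)
qed

text \<open>Centring the coordinate at \<open>x\<close> removes the term containing the derivative of \<open>\<beta>\<close>, so that the cut-off
  coordinates centred at a point behave there, up to the factor \<open>\<beta> x\<close>, like the coordinates themselves.\<close>

lemma coordinate_function_derivative:
  fixes x :: "'e::euclidean_space" and \<beta> :: "'e \<Rightarrow> real"
  assumes "smooth_on UNIV \<beta>"
  shows "frechet_derivative (\<lambda>z. \<beta> z * ((z - x) \<bullet> j)) (at x) v = \<beta> x * (v \<bullet> j)"
proof -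
  have "(\<beta> has_derivative frechet_derivative \<beta> (at x)) (at x)"
    using smooth_on_has_derivative[OF open_UNIV assms] by blast
  then have "((\<lambda>z. \<beta> z * ((z - x) \<bullet> j)) has_derivative
      (\<lambda>v. \<beta> x * (v \<bullet> j) + frechet_derivative \<beta> (at x) v * ((x - x) \<bullet> j))) (at x)"
    by (rule has_derivative_mult) (auto intro!: derivative_eq_intros)
  then have "frechet_derivative (\<lambda>z. \<beta> z * ((z - x) \<bullet> j)) (at x) = (\<lambda>v. \<beta> x * (v \<bullet> j))"
    by (intro frechet_derivative_at[symmetric]) simp
  then show ?thesis
    by simp
qed

text \<open>The values at \<open>p\<close> of the cut-off coordinate fields are, up to a nonzero factor, dual to the cut-off
  coordinate functions centred at \<open>p\<close>.\<close>

lemma independent_vector_field_values: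
  fixes A :: "('a::{t2_space, second_countable_topology}, 'e::euclidean_space) chart set"
  assumes A: "smooth_atlas A"
  obtains X :: "'e \<Rightarrow> 'a vfield"
  where "\<And>i. X i \<in> vector_fields A" "inj_on (\<lambda>i. X i p) Basis" "independent ((\<lambda>i. X i p) ` Basis)"
proof -
  have "p \<in> (\<Union>(U, c)\<in>A. U)"
    using A by (simp add: smooth_atlas_def)
  then obtain U c where U: "(U, c) \<in> A" "p \<in> U"
    by blast
  let ?i = "inv_into U c"
  note U' = atlas_chart[OF A U(1)]
  have ci: "c (?i x) = x" if "x \<in> c ` U" for x
    using U'(3) that homeomorphism_apply2 by metis
  obtain \<beta> :: "'e \<Rightarrow> real" and K where \<beta>: "smooth_on UNIV \<beta>" and K: "compact K" "K \<subseteq> c ` U"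
    and \<beta>p: "\<beta> (c p) \<noteq> 0" and "{x. \<beta> x \<noteq> 0} \<subseteq> K"
    using smooth_bump_exists[OF U'(2), of "c p"] U(2) by blast
  then have supp: "\<beta> x = 0" if "x \<notin> K" for x
    using that by blast
  have \<beta>U: "smooth_on (c ` U) \<beta>"
    by (rule smooth_onI[OF Ck_on_subset[OF smooth_onD[OF \<beta>] subset_UNIV]])
  define X where "X = cutoff_coordinate_field A U c \<beta>"
  \<comment> \<open>The same cut-off is used for the fields and for the coordinates, whence the square below.\<close>
  define y where "y j = extend_by_zero U c (\<lambda>z. \<beta> z * ((z - c p) \<bullet> j))" for j
  have "smooth_on (c ` U) (\<lambda>z. (z - c p) \<bullet> j)" for j
    unfolding diff_conv_add_uminus
    by (intro smooth_onI Ck_on_linear_image[OF U'(2) bounded_linear_inner_left] Ck_on_add[OF U'(2)]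
        Ck_on_const Ck_on_bounded_linear[OF U'(2) bounded_linear_ident])
  then have y: "y j \<in> smooth_functions A" for j
    unfolding y_def
    by (intro extend_by_zero_smooth[OF A U(1) _ K] smooth_on_mult[OF U'(2) \<beta>U]) (auto simp: supp)
  have "X v p (y j) = (\<beta> (c p))\<^sup>2 * (v \<bullet> j)" for v j
  proof -
    have "smooth_on (c ` U) (y j \<circ> ?i)"
      by (rule smooth_functions_chart[OF y U(1)])
    then have "((y j \<circ> ?i) has_derivative frechet_derivative (y j \<circ> ?i) (at (c p))) (at (c p))"
      using smooth_on_has_derivative[OF U'(2)] U(2) by blast
    then have "((\<lambda>z. \<beta> z * ((z - c p) \<bullet> j)) has_derivative frechet_derivative (y j \<circ> ?i) (at (c p))) (at (c p))"
      by (rule has_derivative_transform_within_open[OF _ U'(2)])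
        (use U(2) ci in \<open>auto simp: y_def extend_by_zero_def inv_into_into\<close>)
    then have "frechet_derivative (y j \<circ> ?i) (at (c p)) = frechet_derivative (\<lambda>z. \<beta> z * ((z - c p) \<bullet> j)) (at (c p))"
      by (rule frechet_derivative_at)
    then show ?thesis
      using U(2) y by (simp add: X_def cutoff_coordinate_field_def extend_by_zero_def
          coordinate_function_derivative[OF \<beta>] power2_eq_square)
  qed
  then have dual: "X i p (y j) = (if i = j then (\<beta> (c p))\<^sup>2 else 0)" if "i \<in> Basis" "j \<in> Basis" for i j
    using that by (simp add: inner_Basis)
  have "inj_on (\<lambda>i. X i p) Basis" "independent ((\<lambda>i. X i p) ` Basis)"
    using independent_dual_family[of Basis "(\<beta> (c p))\<^sup>2" "\<lambda>i. X i p" y, OF finite_Basis _ dual] \<beta>p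
    by simp_all
  moreover have "X i \<in> vector_fields A" for i
    unfolding X_def by (rule cutoff_coordinate_field_in_vector_fields[OF A U(1) \<beta>U K supp])
  ultimately show thesis
    using that by blast
qed

lemma linear_on_eq_0_span:
  assumes "linear_on V L" "subspace V" "B \<subseteq> V" "\<And>v. v \<in> B \<Longrightarrow> L v = 0" "v \<in> span B"
  shows "L v = 0"
proof -
  have "subspace {v \<in> V. L v = 0}"
  proof (rule subspaceI)
    have "L (0 *\<^sub>R 0) = 0 *\<^sub>R L 0"
      using assms(1,2) subspace_0 unfolding linear_on_def by blast
    then show "0 \<in> {v \<in> V. L v = 0}"
      using assms(2) subspace_0 by simp
  qed (use assms(1,2) in \<open>auto simp: linear_on_def subspace_add subspace_scale\<close>)
  then have "span B \<subseteq> {v \<in> V. L v = 0}"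
    using assms(3,4) by (intro span_minimal) auto
  then show ?thesis
    using assms(5) by blast
qed

text \<open>The signature fixes the dimension of the space, so an independent subset of that size is a basis.
  Applied to tangent spaces, this shows that derivations are combinations of coordinate derivations by
  counting dimensions instead of by a Taylor expansion.\<close>

lemma has_signature_span_independent:
  assumes "has_signature V b r s" "finite B" "independent B" "card B = r + s" "B \<subseteq> V"
  shows "span B = V"
proof -
  obtain e where e: "inj_on e {..<r + s}" "independent (e ` {..<r + s})" "span (e ` {..<r + s}) = V"
    using assms(1) by (auto simp: has_signature_def)
  have "V \<subseteq> span B"
  proof
    fix v assume v: "v \<in> V"
    show "v \<in> span B"
    proof (rule ccontr)
      assume "v \<notin> span B"
      then have "independent (insert v B)" "v \<notin> B"
        using assms(3) by (auto simp: independent_insert span_base)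
      moreover have "insert v B \<subseteq> span (e ` {..<r + s})"
        using v e(3) assms(5) by auto
      ultimately have "card (insert v B) \<le> card (e ` {..<r + s})"
        using independent_span_bound[of "e ` {..<r + s}" "insert v B"] assms(2) by simp
      then show False
        using assms(2,4) \<open>v \<notin> B\<close> e(1) by (simp add: card_image)
    qed
  qed
  moreover have "span B \<subseteq> V"
    using assms(5) e(3) span_minimal subspace_span by blast
  ultimately show ?thesis by blast
qed

lemma has_signature_nondegenerate:
  assumes sig: "has_signature V b r s"
    and lin: "\<And>u. u \<in> V \<Longrightarrow> linear_on V (b u)"
    and sym: "\<And>u v. u \<in> V \<Longrightarrow> v \<in> V \<Longrightarrow> b u v = b v u"
    and w: "w \<in> V" "\<And>v. v \<in> V \<Longrightarrow> b w v = 0"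
  shows "w = 0"
proof -
  let ?I = "{..<r + s}"
  obtain e where e: "inj_on e ?I" "independent (e ` ?I)" "span (e ` ?I) = V"
    and be: "\<And>i j. i < r + s \<Longrightarrow> j < r + s \<Longrightarrow> b (e i) (e j) = (if i \<noteq> j then 0 else if i < r then 1 else - 1)"
    using sig unfolding has_signature_def by blast
  have V: "subspace V"
    using e(3) subspace_span by blast
  have eV: "e i \<in> V" if "i \<in> ?I" for i
    using e(3) span_base[of "e i" "e ` ?I"] that by blast
  have "w \<in> range (\<lambda>a. \<Sum>v\<in>e ` ?I. a v *\<^sub>R v)"
    using w(1) e(3) span_finite[of "e ` ?I"] by simp
  then obtain a where "w = (\<Sum>v\<in>e ` ?I. a v *\<^sub>R v)"
    by blast
  then have wa: "w = (\<Sum>i\<in>?I. a (e i) *\<^sub>R e i)"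
    using e(1) by (simp add: sum.reindex)
  have expand: "(\<Sum>i\<in>J. a (e i) *\<^sub>R e i) \<in> V \<and>
      b u (\<Sum>i\<in>J. a (e i) *\<^sub>R e i) = (\<Sum>i\<in>J. a (e i) * b u (e i))"
    if "finite J" "J \<subseteq> ?I" "u \<in> V" for J u
    using that(1,2)
  proof (induction J rule: finite_induct)
    case empty
    show ?case
      using linear_on_eq_0_span[OF lin[OF that(3)] V, of "{}"] subspace_0[OF V] by simp
  next
    case (insert i J)
    then have "a (e i) *\<^sub>R e i \<in> V" "e i \<in> V"
      using eV V subspace_scale by blast+
    then show ?case
      using insert lin[OF that(3)] subspace_add[OF V] by (auto simp: linear_on_def)
  qed
  have "a (e j) = 0" if j: "j \<in> ?I" for j
  proof -
    have "0 = b (e j) w"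
      using w sym eV[OF j] by metis
    also have "\<dots> = (\<Sum>i\<in>?I. a (e i) * b (e j) (e i))"
      using expand[OF _ _ eV[OF j], of ?I] wa by simp
    also have "\<dots> = (\<Sum>i\<in>?I. if i = j then a (e j) * b (e j) (e j) else 0)"
      using be j by (intro sum.cong) auto
    also have "\<dots> = a (e j) * b (e j) (e j)"
      using j by simp
    finally show ?thesis
      using be[of j j] j by (auto split: if_splits)
  qed
  then show ?thesis
    unfolding wa by simp
qed

text \<open>Nondegeneracy is a statement about all tangent vectors at \<open>p\<close>, whereas the connection and the
  exterior derivatives only speak of vector fields. The two are reconciled by the fact that the values
  at \<open>p\<close> of suitable vector fields form a basis of the tangent space.\<close>

lemma metric_nondegenerate_on_vector_fields:
  fixes A :: "('a::{t2_space, second_countable_topology}, 'e::euclidean_space) chart set"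
  assumes A: "smooth_atlas A" and g: "pseudo_riemannian_metric A g r s" and dim: "DIM('e) = r + s"
    and w: "w \<in> tangent_space A p" and orth: "\<And>Z. Z \<in> vector_fields A \<Longrightarrow> g p w (Z p) = 0"
  shows "w = 0"
proof -
  let ?V = "tangent_space A p"
  have sig: "has_signature ?V (g p) r s"
    using g by (simp add: pseudo_riemannian_metric_def)
  have lin: "linear_on ?V (g p u)" if "u \<in> ?V" for u
    using g that by (simp add: pseudo_riemannian_metric_def)
  have sym: "g p u v = g p v u" if "u \<in> ?V" "v \<in> ?V" for u v
    using g that unfolding pseudo_riemannian_metric_def by blast
  obtain X :: "'e \<Rightarrow> 'a vfield" where X: "\<And>i. X i \<in> vector_fields A"
    "inj_on (\<lambda>i. X i p) Basis" "independent ((\<lambda>i. X i p) ` Basis)"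
    using independent_vector_field_values[OF A] by blast
  let ?B = "(\<lambda>i. X i p) ` Basis"
  have B: "?B \<subseteq> ?V"
    using X(1) by (auto simp: vector_fields_def)
  have span: "span ?B = ?V"
    by (rule has_signature_span_independent[OF sig _ X(3) _ B]) (simp_all add: card_image[OF X(2)] dim)
  have "g p w v = 0" if "v \<in> ?V" for v
  proof (rule linear_on_eq_0_span[OF lin[OF w] _ B])
    show "subspace ?V"
      using span subspace_span by metis
  qed (use that span X(1) orth in auto)
  then show ?thesis
    using has_signature_nondegenerate[OF sig lin sym w] by blast
qed

section \<open>The module of vector fields\<close>

lemma tangent_space_closed:
  shows "u \<in> tangent_space A p \<Longrightarrow> v \<in> tangent_space A p \<Longrightarrow> u + v \<in> tangent_space A p"
    and "v \<in> tangent_space A p \<Longrightarrow> a *\<^sub>R v \<in> tangent_space A p"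
  unfolding tangent_space_def by (simp_all add: scaleR_fun_def algebra_simps)

lemma vector_field_at: "X \<in> vector_fields A \<Longrightarrow> X p \<in> tangent_space A p"
  by (simp add: vector_fields_def)

lemma vector_fields_add:
  assumes "smooth_atlas A" "X \<in> vector_fields A" "Y \<in> vector_fields A"
  shows "X + Y \<in> vector_fields A"
  using assms by (simp add: vector_fields_def tangent_space_closed smooth_functions_add)

lemma vector_fields_fscale:
  assumes "smooth_atlas A" "f \<in> smooth_functions A" "X \<in> vector_fields A"
  shows "fscale f X \<in> vector_fields A"
proof -
  have "fscale f X p \<in> tangent_space A p" for p
    unfolding fscale_def by (rule tangent_space_closed(2)[OF vector_field_at[OF assms(3)]])
  moreover have "(\<lambda>p. fscale f X p F) \<in> smooth_functions A" if "F \<in> smooth_functions A" for F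
    using assms that by (simp add: fscale_def scaleR_fun_def smooth_functions_mult vector_fields_def)
  ultimately show ?thesis
    by (simp add: vector_fields_def)
qed

lemma vector_fields_diff:
  assumes "smooth_atlas A" "X \<in> vector_fields A" "Y \<in> vector_fields A"
  shows "X - Y \<in> vector_fields A"
proof -
  have "X - Y = X + fscale (\<lambda>p. - 1) Y"
    by (simp add: fscale_def fun_eq_iff scaleR_fun_def)
  moreover have "X + fscale (\<lambda>p. - 1) Y \<in> vector_fields A"
    using assms by (intro vector_fields_add vector_fields_fscale smooth_functions_const)
  ultimately show ?thesis
    by metis
qed

text \<open>The Leibniz rule applied to \<open>1 * 1\<close> gives the case of the constant 1.\<close>

lemma derivation_const:
  assumes "v \<in> tangent_space A p"
  shows "v (\<lambda>q. a) = 0"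
proof -
  have "v (\<lambda>q. 1 * 1) = 1 * v (\<lambda>q. 1) + 1 * v (\<lambda>q. 1)"
    using assms smooth_functions_const[of 1 A] unfolding tangent_space_def mem_Collect_eq by meson
  then have "v (\<lambda>q. 1) = 0"
    by simp
  moreover have "v (\<lambda>q. a * 1) = a * v (\<lambda>q. 1)"
    using assms smooth_functions_const[of 1 A] unfolding tangent_space_def mem_Collect_eq by meson
  ultimately show ?thesis
    by simp
qed

lemma diff_eq_add_scale: "u - v = u + (- 1) *\<^sub>R (v :: 'v::real_vector)"
  by simp

section \<open>Almost paracosymplectic manifolds with their Levi-Civita connection\<close>

locale almost_paracosymplectic_levi_civita =
  fixes n :: nat
    and A :: "('a::{t2_space, second_countable_topology}, 'e::euclidean_space) chart set"
    and \<alpha> :: "'a \<Rightarrow> real"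
    and \<phi> :: "'a tensor11" and \<xi> :: "'a vfield" and \<eta> :: "'a form1" and g :: "'a form2"
    and nabla :: "'a vfield \<Rightarrow> 'a vfield \<Rightarrow> 'a vfield"
  assumes paracosymplectic: "almost_paracosymplectic n A \<alpha> \<phi> \<xi> \<eta> g"
    and levi_civita: "levi_civita_connection A g nabla"
begin

lemma paracontact: "almost_paracontact_metric n A \<phi> \<xi> \<eta> g"
  and alpha_smooth: "\<alpha> \<in> smooth_functions A"
  and d_eta: "X \<in> vector_fields A \<Longrightarrow> Y \<in> vector_fields A \<Longrightarrow> ext_d1 \<eta> X Y p = 0"
  and d_Phi: "X \<in> vector_fields A \<Longrightarrow> Y \<in> vector_fields A \<Longrightarrow> Z \<in> vector_fields A \<Longrightarrow>
    ext_d2 (fundamental_form \<phi> g) X Y Z p = 2 * \<alpha> p * wedge12 \<eta> (fundamental_form \<phi> g) X Y Z p"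
  using paracosymplectic unfolding almost_paracosymplectic_def by blast+

lemma atlas: "smooth_atlas A"
  and dim: "DIM('e) = (n + 1) + n"
  and phi: "is_tensor11 A \<phi>"
  and xi: "\<xi> \<in> vector_fields A"
  and eta: "is_form1 A \<eta>"
  and metric: "pseudo_riemannian_metric A g (n + 1) n"
  and eta_xi: "\<eta> p (\<xi> p) = 1"
  and phi_phi: "v \<in> tangent_space A p \<Longrightarrow> \<phi> p (\<phi> p v) = v - \<eta> p v *\<^sub>R \<xi> p"
  and g_phi_phi: "u \<in> tangent_space A p \<Longrightarrow> v \<in> tangent_space A p \<Longrightarrow>
    g p (\<phi> p u) (\<phi> p v) = - g p u v + \<eta> p u * \<eta> p v"
  using paracontact unfolding almost_paracontact_metric_def by simp_all

lemma phi_in: "v \<in> tangent_space A p \<Longrightarrow> \<phi> p v \<in> tangent_space A p"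
  and phi_add: "u \<in> tangent_space A p \<Longrightarrow> v \<in> tangent_space A p \<Longrightarrow> \<phi> p (u + v) = \<phi> p u + \<phi> p v"
  and phi_scale: "v \<in> tangent_space A p \<Longrightarrow> \<phi> p (a *\<^sub>R v) = a *\<^sub>R \<phi> p v"
  and phi_field: "X \<in> vector_fields A \<Longrightarrow> app11 \<phi> X \<in> vector_fields A"
  using phi unfolding is_tensor11_def linear_on_def by blast+

lemma eta_scale: "v \<in> tangent_space A p \<Longrightarrow> \<eta> p (a *\<^sub>R v) = a * \<eta> p v"
  and eta_smooth: "X \<in> vector_fields A \<Longrightarrow> (\<lambda>p. \<eta> p (X p)) \<in> smooth_functions A"
  using eta unfolding is_form1_def linear_on_def by simp_all

lemma g_sym: "u \<in> tangent_space A p \<Longrightarrow> v \<in> tangent_space A p \<Longrightarrow> g p u v = g p v u"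
  and g_add_right: "u \<in> tangent_space A p \<Longrightarrow> v \<in> tangent_space A p \<Longrightarrow> w \<in> tangent_space A p \<Longrightarrow>
    g p u (v + w) = g p u v + g p u w"
  and g_scale_right: "u \<in> tangent_space A p \<Longrightarrow> v \<in> tangent_space A p \<Longrightarrow> g p u (a *\<^sub>R v) = a * g p u v"
  using metric unfolding pseudo_riemannian_metric_def linear_on_def real_scaleR_def by blast+

lemma tangent_diff: "u \<in> tangent_space A p \<Longrightarrow> v \<in> tangent_space A p \<Longrightarrow> u - v \<in> tangent_space A p"
  unfolding diff_eq_add_scale by (intro tangent_space_closed)

lemma phi_diff: "u \<in> tangent_space A p \<Longrightarrow> v \<in> tangent_space A p \<Longrightarrow> \<phi> p (u - v) = \<phi> p u - \<phi> p v"
  unfolding diff_eq_add_scale by (simp add: phi_add phi_scale tangent_space_closed del: scaleR_minus1_left scaleR_minus_left)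

lemma g_add_left: "u \<in> tangent_space A p \<Longrightarrow> v \<in> tangent_space A p \<Longrightarrow> w \<in> tangent_space A p \<Longrightarrow>
    g p (u + v) w = g p u w + g p v w"
  using g_add_right[of w p u v] g_sym tangent_space_closed by metis

lemma g_scale_left: "u \<in> tangent_space A p \<Longrightarrow> v \<in> tangent_space A p \<Longrightarrow> g p (a *\<^sub>R u) v = a * g p u v"
  using g_scale_right[of v p u a] g_sym tangent_space_closed by metis

lemma g_diff_left: "u \<in> tangent_space A p \<Longrightarrow> v \<in> tangent_space A p \<Longrightarrow> w \<in> tangent_space A p \<Longrightarrow>
    g p (u - v) w = g p u w - g p v w"
  unfolding diff_eq_add_scale
  by (simp add: g_add_left g_scale_left tangent_space_closed del: scaleR_minus1_left scaleR_minus_left)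

lemma g_diff_right: "u \<in> tangent_space A p \<Longrightarrow> v \<in> tangent_space A p \<Longrightarrow> w \<in> tangent_space A p \<Longrightarrow>
    g p w (u - v) = g p w u - g p w v"
  using g_diff_left[of u p v w] g_sym tangent_diff by metis

lemmas g_linear = g_add_left g_add_right g_scale_left g_scale_right g_diff_left g_diff_right

lemma xi_at: "\<xi> p \<in> tangent_space A p"
  by (rule vector_field_at[OF xi])

lemma xi_nonzero: "\<xi> p \<noteq> 0"
  using eta_xi[of p] eta_scale[OF xi_at, of p 0] by auto

text \<open>Since \<open>\<phi>\<^sup>2 \<xi> = 0\<close>, the formula for \<open>\<phi>\<^sup>2\<close> at \<open>w = \<phi> \<xi>\<close> reads \<open>w = \<eta>(w) \<xi>\<close>; applying \<open>\<phi>\<close> once more yields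
  \<open>\<eta>(w) w = 0\<close>.\<close>

lemma phi_xi: "\<phi> p (\<xi> p) = 0"
proof -
  let ?w = "\<phi> p (\<xi> p)"
  have w: "?w \<in> tangent_space A p" and 0: "\<phi> p 0 = 0"
    using phi_in[OF xi_at] phi_scale[OF xi_at, of p 0] by auto
  have "\<phi> p ?w = 0"
    using phi_phi[OF xi_at] by (simp add: eta_xi)
  then have w_eq: "?w = \<eta> p ?w *\<^sub>R \<xi> p"
    using phi_phi[OF w] 0 by simp
  then have "\<eta> p ?w *\<^sub>R ?w = 0"
    using \<open>\<phi> p ?w = 0\<close> phi_scale[OF xi_at] by metis
  then show ?thesis
    using w_eq by (metis scaleR_eq_0_iff)
qed

text \<open>Compute \<open>\<phi>\<^sup>3 v\<close> in two ways: as \<open>\<phi>\<close> of \<open>\<phi>\<^sup>2 v\<close> and as \<open>\<phi>\<^sup>2\<close> of \<open>\<phi> v\<close>.\<close>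

lemma eta_phi:
  assumes v: "v \<in> tangent_space A p"
  shows "\<eta> p (\<phi> p v) = 0"
proof -
  have "\<phi> p (\<phi> p (\<phi> p v)) = \<phi> p v"
    by (simp add: phi_phi[OF v] phi_diff v xi_at tangent_space_closed phi_scale phi_xi)
  then have "\<eta> p (\<phi> p v) *\<^sub>R \<xi> p = 0"
    using phi_phi[OF phi_in[OF v]] by simp
  then show ?thesis
    using xi_nonzero by simp
qed

lemma phi_phi_phi: "v \<in> tangent_space A p \<Longrightarrow> \<phi> p (\<phi> p (\<phi> p v)) = \<phi> p v"
  by (simp add: phi_phi[OF phi_in] eta_phi)

lemma g_zero: "v \<in> tangent_space A p \<Longrightarrow> g p v 0 = 0"
  using g_scale_right[OF _ xi_at, of _ p 0] by simp

lemma g_xi: "v \<in> tangent_space A p \<Longrightarrow> g p v (\<xi> p) = \<eta> p v"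
  using g_phi_phi[OF _ xi_at, of v p] by (simp add: phi_xi eta_xi g_zero phi_in)

lemma g_phi_skew:
  assumes "u \<in> tangent_space A p" "v \<in> tangent_space A p"
  shows "g p (\<phi> p u) v = - g p u (\<phi> p v)"
proof -
  have "g p (\<phi> p u) (\<phi> p (\<phi> p v)) = g p (\<phi> p u) v"
    using assms by (simp add: phi_phi g_linear phi_in xi_at tangent_space_closed g_xi eta_phi)
  then show ?thesis
    using g_phi_phi[OF assms(1) phi_in[OF assms(2)]] assms(2) by (simp add: eta_phi)
qed

subsection \<open>The covariant derivative of the Reeb field\<close>

lemma nabla_field: "X \<in> vector_fields A \<Longrightarrow> Y \<in> vector_fields A \<Longrightarrow> nabla X Y \<in> vector_fields A"
  and nabla_add_left: "X \<in> vector_fields A \<Longrightarrow> X' \<in> vector_fields A \<Longrightarrow> Y \<in> vector_fields A \<Longrightarrow>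
    nabla (X + X') Y = nabla X Y + nabla X' Y"
  and nabla_fscale_left: "f \<in> smooth_functions A \<Longrightarrow> X \<in> vector_fields A \<Longrightarrow> Y \<in> vector_fields A \<Longrightarrow>
    nabla (fscale f X) Y = fscale f (nabla X Y)"
  and nabla_add_right: "X \<in> vector_fields A \<Longrightarrow> Y \<in> vector_fields A \<Longrightarrow> Y' \<in> vector_fields A \<Longrightarrow>
    nabla X (Y + Y') = nabla X Y + nabla X Y'"
  and nabla_fscale_right: "f \<in> smooth_functions A \<Longrightarrow> X \<in> vector_fields A \<Longrightarrow> Y \<in> vector_fields A \<Longrightarrow>
    nabla X (fscale f Y) = fscale (\<lambda>p. X p f) Y + fscale f (nabla X Y)"
  and lie_bracket_eq: "X \<in> vector_fields A \<Longrightarrow> Y \<in> vector_fields A \<Longrightarrow> lie_bracket X Y = nabla X Y - nabla Y X"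
  and metric_compatible: "X \<in> vector_fields A \<Longrightarrow> Y \<in> vector_fields A \<Longrightarrow> Z \<in> vector_fields A \<Longrightarrow>
    X p (\<lambda>q. g q (Y q) (Z q)) = g p (nabla X Y p) (Z p) + g p (Y p) (nabla X Z p)"
  using levi_civita unfolding levi_civita_connection_def affine_connection_def by simp_all

lemma bracket_field: "X \<in> vector_fields A \<Longrightarrow> Y \<in> vector_fields A \<Longrightarrow> lie_bracket X Y \<in> vector_fields A"
  by (simp add: lie_bracket_eq nabla_field vector_fields_diff atlas)

lemmas fields = nabla_field bracket_field phi_field xi

text \<open>This is how identities between vector fields are derived from their inner products with vector fields,
  the only information that metric compatibility and the two exterior derivatives provide.\<close>

lemma field_eqI:
  assumes "X \<in> vector_fields A" "Y \<in> vector_fields A"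
    and "\<And>Z p. Z \<in> vector_fields A \<Longrightarrow> g p (X p) (Z p) = g p (Y p) (Z p)"
  shows "X = Y"
proof
  fix p
  have "X p - Y p = 0"
    by (rule metric_nondegenerate_on_vector_fields[OF atlas metric dim, where p = p])
      (use assms in \<open>simp_all add: vector_field_at tangent_diff g_linear\<close>)
  then show "X p = Y p"
    by simp
qed

text \<open>As \<open>\<eta>\<close> is the metric dual of \<open>\<xi>\<close>, the antisymmetric part of \<open>\<nabla>\<xi>\<close> is \<open>d\<eta>\<close>.\<close>

lemma nabla_xi_self_adjoint:
  assumes X: "X \<in> vector_fields A" and Y: "Y \<in> vector_fields A"
  shows "g p (nabla X \<xi> p) (Y p) = g p (X p) (nabla Y \<xi> p)"
proof -
  have eta_g: "(\<lambda>q. \<eta> q (Z q)) = (\<lambda>q. g q (Z q) (\<xi> q))" if "Z \<in> vector_fields A" for Z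
    using that by (simp add: g_xi vector_field_at)
  have "g p (lie_bracket X Y p) (\<xi> p) = g p (nabla X Y p) (\<xi> p) - g p (nabla Y X p) (\<xi> p)"
    using X Y by (simp add: lie_bracket_eq g_linear vector_field_at nabla_field xi)
  then have "g p (Y p) (nabla X \<xi> p) - g p (X p) (nabla Y \<xi> p) = 0"
    using d_eta[OF X Y, of p] X Y bracket_field[OF X Y] metric_compatible[OF X Y xi, of p] metric_compatible[OF Y X xi, of p]
      g_xi[OF vector_field_at[OF bracket_field[OF X Y]], of p]
    by (simp add: ext_d1_def eta_g)
  then show ?thesis
    using g_sym[of "Y p" p "nabla X \<xi> p"] X Y by (simp add: vector_field_at nabla_field xi)
qed

text \<open>Because \<open>g(\<xi>, \<xi>) = 1\<close>, every \<open>\<nabla>\<^sub>Z \<xi>\<close> is orthogonal to \<open>\<xi>\<close>; self-adjointness moves the derivative to the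
  other slot.\<close>

lemma nabla_xi_xi: "nabla \<xi> \<xi> = 0"
proof (rule field_eqI)
  show "0 \<in> vector_fields A"
    using vector_fields_diff[OF atlas xi xi] by simp
  fix Z p assume Z: "Z \<in> vector_fields A"
  have "Z p (\<lambda>q. g q (\<xi> q) (\<xi> q)) = 0"
    by (simp add: g_xi xi_at eta_xi derivation_const[OF vector_field_at[OF Z]])
  then have "g p (\<xi> p) (nabla Z \<xi> p) = 0"
    using metric_compatible[OF Z xi xi, of p] g_sym[of "\<xi> p" p "nabla Z \<xi> p"] Z
    by (simp add: vector_field_at nabla_field xi)
  then show "g p (nabla \<xi> \<xi> p) (Z p) = g p (0 p) (Z p)"
    using nabla_xi_self_adjoint[OF xi Z] Z g_sym[of 0 p "Z p"] g_zero[of "Z p" p]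
      vector_field_at[OF Z] tangent_diff[OF xi_at xi_at] by simp
qed (simp add: nabla_field xi)

lemma phi_phi_field:
  "X \<in> vector_fields A \<Longrightarrow> X = app11 \<phi> (app11 \<phi> X) + fscale (\<lambda>p. \<eta> p (X p)) \<xi>"
  by (rule ext) (simp only: app11_def fscale_def plus_fun_apply phi_phi vector_field_at diff_add_cancel)

lemma nabla_phi_phi_xi:
  assumes X: "X \<in> vector_fields A"
  shows "nabla (app11 \<phi> (app11 \<phi> X)) \<xi> = nabla X \<xi>"
proof -
  have "nabla X \<xi> = nabla (app11 \<phi> (app11 \<phi> X)) \<xi> + nabla (fscale (\<lambda>p. \<eta> p (X p)) \<xi>) \<xi>"
    by (subst phi_phi_field[OF X])
      (intro nabla_add_left phi_field X xi vector_fields_fscale atlas eta_smooth)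
  also have "nabla (fscale (\<lambda>p. \<eta> p (X p)) \<xi>) \<xi> = 0"
    by (simp add: nabla_fscale_left eta_smooth X xi nabla_xi_xi) (simp add: fscale_def fun_eq_iff)
  finally show ?thesis
    by simp
qed

subsection \<open>The tensor \<open>h\<close>\<close>

lemma h_tensor_at: "h_tensor \<phi> \<xi> X p =
    (1 / 2) *\<^sub>R (lie_bracket \<xi> (app11 \<phi> X) p - \<phi> p (lie_bracket \<xi> X p))"
  by (simp add: h_tensor_def lie_derivative11_def app11_def scaleR_fun_def fun_eq_iff)

lemma h_field:
  assumes "X \<in> vector_fields A"
  shows "h_tensor \<phi> \<xi> X \<in> vector_fields A"
proof -
  have "h_tensor \<phi> \<xi> X = fscale (\<lambda>p. 1 / 2) (lie_derivative11 \<xi> \<phi> X)"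
    by (simp add: h_tensor_def fscale_def scaleR_fun_def fun_eq_iff)
  then show ?thesis
    using assms
    by (simp add: lie_derivative11_def vector_fields_fscale vector_fields_diff atlas smooth_functions_const fields)
qed

text \<open>This carries the geometric content of \<open>d\<Phi> = 2\<alpha> \<eta>\<and>\<Phi>\<close>. Inserting \<open>\<xi>\<close> kills every term with \<open>\<Phi>(\<cdot>, \<xi>)\<close>, so the
  equation says that the Lie derivative of \<open>\<Phi>\<close> along \<open>\<xi>\<close> is \<open>2\<alpha>\<Phi>\<close>. On the other hand the product rule for
  \<open>\<Phi>(X, Y) = g(\<phi>X, Y)\<close> gives that Lie derivative as \<open>2 g(hX, Y)\<close>, from \<open>\<phi>\<close>, plus the Lie derivative of \<open>g\<close>,
  which by self-adjointness of \<open>\<nabla>\<xi>\<close> is \<open>2 g(\<nabla>\<^bsub>\<phi>X\<^esub> \<xi>, Y)\<close>.\<close>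

lemma g_h:
  assumes X: "X \<in> vector_fields A" and Y: "Y \<in> vector_fields A"
  shows "g p (h_tensor \<phi> \<xi> X p) (Y p) = \<alpha> p * g p (\<phi> p (X p)) (Y p) - g p (nabla (app11 \<phi> X) \<xi> p) (Y p)"
proof -
  have zero: "g q (\<phi> q (Z q)) (\<xi> q) = 0" "g q (\<phi> q (\<xi> q)) (Z q) = 0" if "Z \<in> vector_fields A" for Z q
    using that g_phi_skew[OF xi_at, of "Z q" q] g_sym[OF xi_at phi_in, of "Z q" q]
    by (simp_all add: g_xi phi_in vector_field_at eta_phi)
  \<comment> \<open>The structure equation evaluated on \<open>\<xi>, X, Y\<close>.\<close>
  have "\<xi> p (\<lambda>q. g q (\<phi> q (X q)) (Y q)) - g p (\<phi> p (lie_bracket \<xi> X p)) (Y p) - g p (\<phi> p (lie_bracket Y \<xi> p)) (X p)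
      = 2 * \<alpha> p * g p (\<phi> p (X p)) (Y p)"
    using d_Phi[OF xi X Y, of p] X Y
    by (simp add: ext_d2_def wedge12_def fundamental_form_def zero eta_xi bracket_field derivation_const[OF vector_field_at])
  moreover have "\<xi> p (\<lambda>q. g q (\<phi> q (X q)) (Y q)) =
      g p (nabla \<xi> (app11 \<phi> X) p) (Y p) + g p (\<phi> p (X p)) (nabla \<xi> Y p)"
    using metric_compatible[OF xi phi_field[OF X] Y, of p] by (simp add: app11_def)
  moreover have "g p (\<phi> p (lie_bracket Y \<xi> p)) (X p) =
      g p (\<phi> p (X p)) (nabla \<xi> Y p) - g p (nabla (app11 \<phi> X) \<xi> p) (Y p)"
  proof -
    have "g p (\<phi> p (lie_bracket Y \<xi> p)) (X p) = - g p (nabla Y \<xi> p - nabla \<xi> Y p) (\<phi> p (X p))"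
      using X Y by (simp add: g_phi_skew fields vector_field_at) (simp add: lie_bracket_eq X Y xi)
    also have "\<dots> = g p (\<phi> p (X p)) (nabla \<xi> Y p) - g p (\<phi> p (X p)) (nabla Y \<xi> p)"
      using g_sym[of "\<phi> p (X p)" p] X Y by (simp add: g_linear fields vector_field_at phi_in)
    finally show ?thesis
      using nabla_xi_self_adjoint[OF phi_field[OF X] Y, of p] by (simp add: app11_def)
  qed
  \<comment> \<open>The definition of \<open>h\<close>, with \<open>[\<xi>, \<phi>X]\<close> replaced by covariant derivatives but \<open>[\<xi>, X]\<close> kept, to match
    the first equation.\<close>
  moreover have "g p (h_tensor \<phi> \<xi> X p) (Y p) = (1 / 2) * (g p (nabla \<xi> (app11 \<phi> X) p) (Y p)
      - g p (nabla (app11 \<phi> X) \<xi> p) (Y p) - g p (\<phi> p (lie_bracket \<xi> X p)) (Y p))"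
    using X Y
    by (simp add: h_tensor_at g_linear fields vector_field_at phi_in tangent_diff)
      (simp add: lie_bracket_eq fields X g_linear vector_field_at)
  ultimately show ?thesis
    by simp
qed

lemma h_eq:
  assumes X: "X \<in> vector_fields A"
  shows "h_tensor \<phi> \<xi> X = fscale \<alpha> (app11 \<phi> X) - nabla (app11 \<phi> X) \<xi>"
proof (rule field_eqI)
  show "g p (h_tensor \<phi> \<xi> X p) (Z p) = g p ((fscale \<alpha> (app11 \<phi> X) - nabla (app11 \<phi> X) \<xi>) p) (Z p)"
    if "Z \<in> vector_fields A" for Z p
    using g_h[OF X that, of p] that X
    by (simp add: fscale_def app11_def g_linear phi_in vector_field_at fields[unfolded app11_def] tangent_space_closed)
qed (use X in \<open>simp_all add: h_field vector_fields_diff vector_fields_fscale atlas alpha_smooth fields\<close>)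

text \<open>By the Leibniz rule the left-hand side is half the Lie derivative of \<open>\<phi>\<^sup>2 = Id - \<eta> \<otimes> \<xi>\<close> along \<open>\<xi>\<close>. It vanishes
  because that of \<open>\<eta>\<close> does: as \<open>\<eta>(\<xi>)\<close> is constant, its value at \<open>X\<close> is \<open>d\<eta>(\<xi>, X)\<close>.\<close>

lemma h_phi_anticommute:
  assumes X: "X \<in> vector_fields A"
  shows "h_tensor \<phi> \<xi> (app11 \<phi> X) + app11 \<phi> (h_tensor \<phi> \<xi> X) = 0"
proof
  fix p
  let ?X' = "app11 \<phi> (app11 \<phi> X)" and ?f = "\<lambda>p. \<eta> p (X p)"
  have X': "?X' \<in> vector_fields A" and f: "?f \<in> smooth_functions A"
    using X by (simp_all add: phi_field eta_smooth)
  \<comment> \<open>Differentiate \<open>X = \<phi>\<^sup>2 X + \<eta>(X) \<xi>\<close> along \<open>\<xi>\<close>.\<close>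
  have "nabla \<xi> X = nabla \<xi> ?X' + nabla \<xi> (fscale ?f \<xi>)"
    by (subst phi_phi_field[OF X]) (intro nabla_add_right X' xi vector_fields_fscale atlas f)
  also have "nabla \<xi> (fscale ?f \<xi>) = fscale (\<lambda>p. \<xi> p ?f) \<xi>"
    by (simp add: nabla_fscale_right f xi nabla_xi_xi) (simp add: fscale_def fun_eq_iff)
  finally have "nabla \<xi> X = nabla \<xi> ?X' + fscale (\<lambda>p. \<xi> p ?f) \<xi>" .
  from fun_cong[OF this, of p] have "nabla \<xi> X p = nabla \<xi> ?X' p + \<xi> p ?f *\<^sub>R \<xi> p"
    by (simp add: fscale_def)
  then have "lie_bracket \<xi> X p = lie_bracket \<xi> ?X' p + \<xi> p ?f *\<^sub>R \<xi> p"
    using X X' by (simp add: lie_bracket_eq xi nabla_phi_phi_xi algebra_simps)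
  moreover have "\<eta> p (lie_bracket \<xi> X p) = \<xi> p ?f"
    using d_eta[OF xi X, of p] X by (simp add: ext_d1_def eta_xi derivation_const[OF vector_field_at])
  ultimately have bracket: "lie_bracket \<xi> ?X' p = \<phi> p (\<phi> p (lie_bracket \<xi> X p))"
    unfolding phi_phi[OF vector_field_at[OF bracket_field[OF xi X]]] by (metis add_diff_cancel_right')
  have "\<phi> p (h_tensor \<phi> \<xi> X p) =
      (1 / 2) *\<^sub>R (\<phi> p (lie_bracket \<xi> (app11 \<phi> X) p) - \<phi> p (\<phi> p (lie_bracket \<xi> X p)))"
    using X by (simp add: h_tensor_at phi_scale phi_diff phi_in fields vector_field_at tangent_diff)
  then show "(h_tensor \<phi> \<xi> (app11 \<phi> X) + app11 \<phi> (h_tensor \<phi> \<xi> X)) p = 0 p"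
    using bracket h_tensor_at[of "app11 \<phi> X" p]
    by (simp add: app11_def[of _ "h_tensor _ _ _"] scaleR_right_diff_distrib)
qed

lemma h_xi: "h_tensor \<phi> \<xi> \<xi> = 0"
proof -
  \<comment> \<open>Writing the zero field as \<open>0 \<cdot> \<xi>\<close> makes linearity of the connection over functions apply to it.\<close>
  have phi_xi_field: "app11 \<phi> \<xi> = fscale (\<lambda>p. 0) \<xi>"
    by (rule ext) (simp only: app11_def fscale_def phi_xi scaleR_zero_left)
  show ?thesis
    unfolding h_eq[OF xi] phi_xi_field nabla_fscale_left[OF smooth_functions_const xi xi]
    by (simp add: fscale_def fun_eq_iff scaleR_fun_def)
qed

text \<open>Anticommutation turns the left-hand side into \<open>- h(\<phi>X)\<close>, and in \<open>h_eq\<close> for \<open>\<phi>X\<close> the \<open>\<xi>\<close>-component that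
  separates \<open>\<phi>\<^sup>2 X\<close> from \<open>X\<close> is annihilated by \<open>\<nabla>\<xi>\<close>.\<close>

lemma phi_h_eq:
  assumes X: "X \<in> vector_fields A"
  shows "app11 \<phi> (h_tensor \<phi> \<xi> X) = nabla X \<xi> - fscale \<alpha> (app11 \<phi> (app11 \<phi> X))"
proof -
  have "app11 \<phi> (h_tensor \<phi> \<xi> X) = - h_tensor \<phi> \<xi> (app11 \<phi> X)"
    by (rule minus_unique[OF h_phi_anticommute[OF X], symmetric])
  then show ?thesis
    unfolding h_eq[OF phi_field[OF X]] nabla_phi_phi_xi[OF X] by simp
qed

text \<open>A second expression for \<open>hX\<close>, with \<open>\<phi>\<close> after instead of before \<open>\<nabla>\<xi>\<close>. As \<open>\<nabla>\<xi>\<close> is self-adjoint and \<open>\<phi>\<close>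
  skew, it is the adjoint of the expression in \<open>h_eq\<close>.\<close>

lemma h_eq_phi_nabla:
  assumes X: "X \<in> vector_fields A"
  shows "h_tensor \<phi> \<xi> X = app11 \<phi> (nabla X \<xi>) - fscale \<alpha> (app11 \<phi> X)"
proof -
  let ?Y = "app11 \<phi> X"
  have "app11 \<phi> (app11 \<phi> ?Y) = ?Y"
    by (rule ext) (simp only: app11_def phi_phi_phi[OF vector_field_at[OF X]])
  then have "h_tensor \<phi> \<xi> X = h_tensor \<phi> \<xi> (app11 \<phi> ?Y)"
    using X by (simp add: h_eq phi_field)
  also have "\<dots> = - app11 \<phi> (h_tensor \<phi> \<xi> ?Y)"
    by (rule eq_neg_iff_add_eq_0[THEN iffD2, OF h_phi_anticommute[OF phi_field[OF X]]])
  also have "\<dots> = app11 \<phi> (nabla X \<xi>) - fscale \<alpha> ?Y"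
  proof
    fix p
    have "h_tensor \<phi> \<xi> ?Y p = \<alpha> p *\<^sub>R \<phi> p (\<phi> p (X p)) - nabla X \<xi> p"
      unfolding h_eq[OF phi_field[OF X]] nabla_phi_phi_xi[OF X] by (simp add: fscale_def app11_def)
    then have "\<phi> p (h_tensor \<phi> \<xi> ?Y p) = \<alpha> p *\<^sub>R \<phi> p (X p) - \<phi> p (nabla X \<xi> p)"
      using X by (simp add: phi_diff phi_scale phi_phi_phi phi_in tangent_space_closed fields vector_field_at)
    then show "(- app11 \<phi> (h_tensor \<phi> \<xi> ?Y)) p = (app11 \<phi> (nabla X \<xi>) - fscale \<alpha> ?Y) p"
      by (simp add: app11_def fscale_def)
  qed
  finally show ?thesis .
qed

text \<open>The two expressions \<open>\<phi>(\<nabla>\<^sub>X \<xi>) - \<alpha> \<phi>X\<close> and \<open>\<alpha> \<phi>X - \<nabla>\<^bsub>\<phi>X\<^esub> \<xi>\<close> for \<open>hX\<close> are adjoint to each other.\<close>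

lemma h_self_adjoint:
  assumes X: "X \<in> vector_fields A" and Y: "Y \<in> vector_fields A"
  shows "g p (h_tensor \<phi> \<xi> X p) (Y p) = g p (X p) (h_tensor \<phi> \<xi> Y p)"
proof -
  have "h_tensor \<phi> \<xi> X p = \<phi> p (nabla X \<xi> p) - \<alpha> p *\<^sub>R \<phi> p (X p)"
    using fun_cong[OF h_eq_phi_nabla[OF X], of p] by (simp add: app11_def fscale_def)
  then have "g p (h_tensor \<phi> \<xi> X p) (Y p) = \<alpha> p * g p (X p) (\<phi> p (Y p)) - g p (nabla X \<xi> p) (\<phi> p (Y p))"
    using X Y by (simp add: g_linear phi_in tangent_space_closed fields vector_field_at g_phi_skew)
  also have "\<dots> = g p (X p) (h_tensor \<phi> \<xi> Y p)"
    using nabla_xi_self_adjoint[OF X phi_field[OF Y], of p] X Y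
    by (simp add: h_eq fscale_def app11_def g_linear phi_in tangent_space_closed vector_field_at
        fields[unfolded app11_def])
  finally show ?thesis .
qed

end

theorem proposition3:
  fixes n :: nat
    and A :: "('a::{t2_space, second_countable_topology}, 'e::euclidean_space) chart set"
    and \<alpha> :: "'a \<Rightarrow> real"
    and \<phi> :: "'a tensor11" and \<xi> :: "'a vfield" and \<eta> :: "'a form1" and g :: "'a form2"
    and nabla :: "'a vfield \<Rightarrow> 'a vfield \<Rightarrow> 'a vfield"
  assumes "almost_paracosymplectic n A \<alpha> \<phi> \<xi> \<eta> g"
    and "levi_civita_connection A g nabla"
  shows "(\<forall>X\<in>vector_fields A. \<forall>Y\<in>vector_fields A. \<forall>p.
            g p (h_tensor \<phi> \<xi> X p) (Y p) = g p (X p) (h_tensor \<phi> \<xi> Y p))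
       \<and> (\<forall>X\<in>vector_fields A. h_tensor \<phi> \<xi> (app11 \<phi> X) + app11 \<phi> (h_tensor \<phi> \<xi> X) = 0)
       \<and> h_tensor \<phi> \<xi> \<xi> = 0
       \<and> (\<forall>X\<in>vector_fields A.
            nabla X \<xi> = fscale \<alpha> (app11 \<phi> (app11 \<phi> X)) + app11 \<phi> (h_tensor \<phi> \<xi> X)
          \<and> fscale \<alpha> (app11 \<phi> (app11 \<phi> X)) + app11 \<phi> (h_tensor \<phi> \<xi> X) = - A_tensor nabla \<xi> X)"
proof -
  interpret almost_paracosymplectic_levi_civita n A \<alpha> \<phi> \<xi> \<eta> g nabla
    using assms by unfold_locales
  have "nabla X \<xi> = fscale \<alpha> (app11 \<phi> (app11 \<phi> X)) + app11 \<phi> (h_tensor \<phi> \<xi> X)" if "X \<in> vector_fields A" for X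
    using phi_h_eq[OF that] by simp
  then show ?thesis
    by (simp add: h_self_adjoint h_phi_anticommute h_xi A_tensor_def)
qed

end
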